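(* Let $\ell>0$ and let the vocal-tract radius $r$ belong to class $\mathcal{A}$ on $[0,\ell]$. Then the quantity $P(k,\ell)$ (the pressure at the lips) is given by $$P(k,\ell)=-\frac{ikc\mu}{\pi r_0\,r_\ell}\,\frac{z(k)}{G(k)},\qquad k\in\mathbf{C},$$ as an identity of meromorphic functions of $k$.
   Context: Class $\mathcal{A}$: $r:[0,\ell]\to\mathbf{R}$ with $r(x)>0$ on $[0,\ell]$, $r'$ continuous on $[0,\ell]$ (and absolutely continuous), $r''$ integrable on $(0,\ell)$. Notation: prime is $d/dx$, $r_0=r(0)$, $r_\ell=r(\ell)$, $r_0'=r'(0)$, $r_\ell'=r'(\ell)$. The constants $c,\mu>0$ are fixed. Normalized impedance: $z(k)=1-\dfrac{J_1(2kr_\ell)}{kr_\ell}+i\,\dfrac{\mathbf{H}_1(2kr_\ell)}{kr_\ell}$, $k\in\mathbf{C}$ (value at $k=0$ by removing the singularity), $J_1$ the Bessel function and $\mathbf{H}_1$ the Struve function of order one. With $q(x)=r''(x)/r(x)$, let $\varphi(k,x)$ and $g(k,x)$ be the solutions of $-\psi''+q\psi=k^2\psi$ on $(0,\ell)$ with $\varphi(k,0)=1$, $\varphi'(k,0)=r_0'/r_0$ and $g(k,\ell)=z(k)$, $g'(k,\ell)=\dfrac{r_\ell'}{r_\ell}z(k)-ik$. Set $G(k)=\varphi(k,x)g'(k,x)-\varphi'(k,x)g(k,x)$, which is independent of $x$. $P(k,x)$ is the unique solution of $[r(x)^2P'(k,x)]'+k^2r(x)^2P(k,x)=0$ on $(0,\ell)$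 with $P'(k,0)=-\dfrac{ikc\mu}{\pi r_0^2}$ and $P'(k,\ell)+\dfrac{ik}{z(k)}P(k,\ell)=0$, for those $k\in\mathbf{C}$ with $z(k)\ne0$ and $G(k)\ne0$, extended meromorphically in $k$. *)

theory Defs
  imports "HOL-Complex_Analysis.Complex_Analysis"
begin

(* Derivative of a function on [0,l]: one-sided at the endpoints, the ordinary derivative inside. *)
definition ideriv :: "real \<Rightarrow> (real \<Rightarrow> 'a::real_normed_vector) \<Rightarrow> real \<Rightarrow> 'a" where
  "ideriv l f x = vector_derivative f (at x within {0..l})"

definition abs_continuous_on :: "real \<Rightarrow> real \<Rightarrow> (real \<Rightarrow> 'a::real_normed_vector) \<Rightarrow> bool" where
  "abs_continuous_on a b f \<longleftrightarrow>
     (\<forall>\<epsilon>>0. \<exists>\<delta>>0. \<forall>(n::nat) u v.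
        (\<forall>i<n. a \<le> u i \<and> u i \<le> v i \<and> v i \<le> b) \<and>
        disjoint_family_on (\<lambda>i. {u i<..<v i}) {..<n} \<and>
        (\<Sum>i<n. v i - u i) < \<delta>
        \<longrightarrow> (\<Sum>i<n. norm (f (v i) - f (u i))) < \<epsilon>)"

(* The differentiability clause says that r'' exists almost everywhere (as it does for every
   absolutely continuous r'); without it, ideriv would be an arbitrary value. *)
definition class_A :: "real \<Rightarrow> (real \<Rightarrow> real) \<Rightarrow> bool" where
  "class_A l r \<longleftrightarrow>
     (\<forall>x\<in>{0..l}. r x > 0) \<and>
     r differentiable_on {0..l} \<and>
     continuous_on {0..l} (ideriv l r) \<and>
     abs_continuous_on 0 l (ideriv l r) \<and>
     (AE x\<in>{0<..<l} in lebesgue. ideriv l r differentiable (at x)) \<and>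
     ideriv l (ideriv l r) absolutely_integrable_on {0<..<l}"

(* Power series of the Bessel function of the first kind and of the Struve function,
   of integer order n \<ge> 0; both converge on the whole plane. *)
definition Bessel_J :: "nat \<Rightarrow> complex \<Rightarrow> complex" where
  "Bessel_J n w = (\<Sum>m. (-1) ^ m / (fact m * fact (m + n)) * (w / 2) ^ (2 * m + n))"

definition Struve_H :: "nat \<Rightarrow> complex \<Rightarrow> complex" where
  "Struve_H n w = (\<Sum>m. (-1) ^ m / (Gamma (of_nat m + 3 / 2) * Gamma (of_nat (m + n) + 3 / 2))
                        * (w / 2) ^ (2 * m + n + 1))"

(* remove_sings fills in the value at k = 0. *)
definition impedance :: "real \<Rightarrow> (real \<Rightarrow> real) \<Rightarrow> complex \<Rightarrow> complex" where
  "impedance l r =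
     remove_sings (\<lambda>k. 1 - Bessel_J 1 (2 * k * of_real (r l)) / (k * of_real (r l))
                         + \<i> * (Struve_H 1 (2 * k * of_real (r l)) / (k * of_real (r l))))"

definition potential :: "real \<Rightarrow> (real \<Rightarrow> real) \<Rightarrow> real \<Rightarrow> real" where
  "potential l r x = ideriv l (ideriv l r) x / r x"

(* Solutions of -psi'' + q psi = k^2 psi on (0,l).  As q is only integrable, they are taken in the
   Caratheodory sense: psi' is absolutely continuous and the equation holds almost everywhere. *)
definition schroedinger_sol ::
    "real \<Rightarrow> (real \<Rightarrow> real) \<Rightarrow> complex \<Rightarrow> (real \<Rightarrow> complex) \<Rightarrow> bool" where
  "schroedinger_sol l r k \<psi> \<longleftrightarrow>
     \<psi> differentiable_on {0..l} \<and>
     abs_continuous_on 0 l (ideriv l \<psi>) \<and>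
     (AE x\<in>{0<..<l} in lebesgue.
        ideriv l \<psi> differentiable (at x) \<and>
        - ideriv l (ideriv l \<psi>) x + of_real (potential l r x) * \<psi> x = k\<^sup>2 * \<psi> x)"

(* Here and below, extensional pins down the irrelevant values outside [0,l], so that the
   description is of a single function. *)
definition phi :: "real \<Rightarrow> (real \<Rightarrow> real) \<Rightarrow> complex \<Rightarrow> real \<Rightarrow> complex" where
  "phi l r k = (THE \<psi>. \<psi> \<in> extensional {0..l} \<and> schroedinger_sol l r k \<psi> \<and>
      \<psi> 0 = 1 \<and> ideriv l \<psi> 0 = of_real (ideriv l r 0 / r 0))"

definition jost :: "real \<Rightarrow> (real \<Rightarrow> real) \<Rightarrow> complex \<Rightarrow> real \<Rightarrow> complex" where
  "jost l r k = (THE \<psi>. \<psi> \<in> extensional {0..l} \<and> schroedinger_sol l r k \<psi> \<and>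
      \<psi> l = impedance l r k \<and>
      ideriv l \<psi> l = of_real (ideriv l r l / r l) * impedance l r k - \<i> * k)"

(* The common value of the Wronskian of phi and g (here: jost) at the points of [0,l]. *)
definition G :: "real \<Rightarrow> (real \<Rightarrow> real) \<Rightarrow> complex \<Rightarrow> complex" where
  "G l r k = (THE w. \<forall>x\<in>{0..l}.
      phi l r k x * ideriv l (jost l r k) x - ideriv l (phi l r k) x * jost l r k x = w)"

definition pressure_bvp ::
    "real \<Rightarrow> (real \<Rightarrow> real) \<Rightarrow> real \<Rightarrow> real \<Rightarrow> complex \<Rightarrow> (real \<Rightarrow> complex) \<Rightarrow> bool" where
  "pressure_bvp l r c \<mu> k p \<longleftrightarrow>
     p differentiable_on {0..l} \<and>
     continuous_on {0..l} (ideriv l p) \<and>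
     (\<forall>x\<in>{0<..<l}.
        ((\<lambda>y. of_real ((r y)\<^sup>2) * ideriv l p y)
           has_vector_derivative - (k\<^sup>2 * of_real ((r x)\<^sup>2) * p x)) (at x)) \<and>
     ideriv l p 0 = - (\<i> * k * of_real (c * \<mu>) / of_real (pi * (r 0)\<^sup>2)) \<and>
     ideriv l p l + \<i> * k / impedance l r k * p l = 0"

definition pressure_sol ::
    "real \<Rightarrow> (real \<Rightarrow> real) \<Rightarrow> real \<Rightarrow> real \<Rightarrow> complex \<Rightarrow> real \<Rightarrow> complex" where
  "pressure_sol l r c \<mu> k = (THE p. p \<in> extensional {0..l} \<and> pressure_bvp l r c \<mu> k p)"

(* The meromorphic extension in k: at an exceptional k, the limit of the values at nearby k,
   or 0 at a pole. *)
definition pressure ::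
    "real \<Rightarrow> (real \<Rightarrow> real) \<Rightarrow> real \<Rightarrow> real \<Rightarrow> complex \<Rightarrow> real \<Rightarrow> complex" where
  "pressure l r c \<mu> k x =
     (if impedance l r k \<noteq> 0 \<and> G l r k \<noteq> 0 then pressure_sol l r c \<mu> k x
      else remove_sings (\<lambda>k'. pressure_sol l r c \<mu> k' x) k)"

end

theory Submission
  imports Defs
begin

text \<open>
  For \<open>\<psi> = r P\<close> and \<open>V = r\<^sup>2 P'\<close> the Schroedinger equation and the equation for the pressure both
  become the system \<open>P' = V / r\<^sup>2\<close>, \<open>V' = - k\<^sup>2 r\<^sup>2 P\<close> with continuous coefficients. Let \<open>(C, VC)\<close> and
  \<open>(D, VD)\<close> be its solutions with data \<open>(1, 0)\<close> and \<open>(0, 1)\<close> at \<open>0\<close>, which are entire in \<open>k\<close> (power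
  series in \<open>k\<^sup>2\<close>) and have Wronskian \<open>C VD - D VC = 1\<close>. At \<open>x = \<ell>\<close> the Wronskian of \<open>\<phi>\<close> and \<open>g\<close> is
  \<open>G = - (i k r\<^sub>\<ell> C + z VC / r\<^sub>\<ell>) / r\<^sub>0\<close>. The condition at \<open>0\<close> makes the pressure \<open>P = a C + b D\<close> with
  \<open>b = - i k c \<mu> / \<pi>\<close>; solving the condition at \<open>\<ell>\<close> for \<open>a\<close> divides by \<open>- r\<^sub>0 r\<^sub>\<ell> G\<close>, and the Wronskian
  identity turns \<open>P(\<ell>)\<close> into \<open>b z / (r\<^sub>0 r\<^sub>\<ell> G)\<close>. Finally \<open>G\<close> has a simple zero at \<open>0\<close> and \<open>z\<close> has a nonzero
  odd part, so neither vanishes identically.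
\<close>

section \<open>Absolutely continuous functions\<close>

text \<open>Over any family of intervals the increments of \<open>h\<close> are controlled by those
  of \<open>f\<close> and \<open>g\<close>, so the smaller of their two deltas serves
  \<open>h\<close>. The closure properties below are instances, with \<open>f = g\<close> where a
  single function is at hand.\<close>

lemma abs_continuous_on_dominated:
  assumes f: "abs_continuous_on a b f" and g: "abs_continuous_on a b g"
    and "M \<ge> 0"
    and bound: "\<And>u v. a \<le> u \<Longrightarrow> u \<le> v \<Longrightarrow> v \<le> b \<Longrightarrow>
      norm (h v - h u) \<le> M * (norm (f v - f u) + norm (g v - g u))"
  shows "abs_continuous_on a b h"
  unfolding abs_continuous_on_def
proof (intro allI impI)
  fix \<epsilon> :: real assume "\<epsilon> > 0"
  \<comment> \<open>Half for each of \<open>f\<close> and \<open>g\<close>; \<open>M + 1\<close>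
    instead of \<open>M\<close> allows \<open>M = 0\<close> and makes the last estimate
    strict.\<close>
  define \<eta> where "\<eta> = \<epsilon> / (M + 1) / 2"
  have "\<eta> > 0" using \<open>\<epsilon> > 0\<close> \<open>M \<ge> 0\<close> by (simp add: \<eta>_def)
  obtain d1 where "d1 > 0" and d1: "\<And>n u v.
        (\<forall>i<(n::nat). a \<le> u i \<and> u i \<le> v i \<and> v i \<le> b) \<and>
        disjoint_family_on (\<lambda>i. {u i<..<v i}) {..<n} \<and> (\<Sum>i<n. v i - u i) < d1
        \<Longrightarrow> (\<Sum>i<n. norm (f (v i) - f (u i))) < \<eta>"
    using f \<open>\<eta> > 0\<close> unfolding abs_continuous_on_def by meson
  obtain d2 where "d2 > 0" and d2: "\<And>n u v.
        (\<forall>i<(n::nat). a \<le> u i \<and> u i \<le> v i \<and> v i \<le> b) \<and>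
        disjoint_family_on (\<lambda>i. {u i<..<v i}) {..<n} \<and> (\<Sum>i<n. v i - u i) < d2
        \<Longrightarrow> (\<Sum>i<n. norm (g (v i) - g (u i))) < \<eta>"
    using g \<open>\<eta> > 0\<close> unfolding abs_continuous_on_def by meson
  show "\<exists>\<delta>>0. \<forall>(n::nat) u v. (\<forall>i<n. a \<le> u i \<and> u i \<le> v i \<and> v i \<le> b) \<and>
        disjoint_family_on (\<lambda>i. {u i<..<v i}) {..<n} \<and> (\<Sum>i<n. v i - u i) < \<delta>
        \<longrightarrow> (\<Sum>i<n. norm (h (v i) - h (u i))) < \<epsilon>"
  proof (intro exI[of _ "min d1 d2"] conjI allI impI)
    show "min d1 d2 > 0" using \<open>d1 > 0\<close> \<open>d2 > 0\<close> by simp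
    fix n :: nat and u v
    assume *: "(\<forall>i<n. a \<le> u i \<and> u i \<le> v i \<and> v i \<le> b) \<and>
        disjoint_family_on (\<lambda>i. {u i<..<v i}) {..<n} \<and> (\<Sum>i<n. v i - u i) < min d1 d2"
    have "(\<Sum>i<n. norm (h (v i) - h (u i)))
        \<le> (\<Sum>i<n. M * (norm (f (v i) - f (u i)) + norm (g (v i) - g (u i))))"
      using * by (intro sum_mono bound) auto
    also have "\<dots> = M * ((\<Sum>i<n. norm (f (v i) - f (u i))) + (\<Sum>i<n. norm (g (v i) - g (u i))))"
      by (simp add: sum_distrib_left sum.distrib distrib_left)
    also have "\<dots> \<le> M * (\<eta> + \<eta>)"
      using d1[of n u v] d2[of n u v] * \<open>M \<ge> 0\<close> by (intro mult_left_mono add_mono) auto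
    also have "\<dots> < (M + 1) * (\<eta> + \<eta>)"
      using \<open>\<eta> > 0\<close> by simp
    also have "\<eta> + \<eta> = \<epsilon> / (M + 1)"
      unfolding \<eta>_def by (rule field_sum_of_halves)
    also have "(M + 1) * (\<epsilon> / (M + 1)) = \<epsilon>"
      using \<open>M \<ge> 0\<close> by (intro nonzero_mult_div_cancel_left[of "M + 1", folded times_divide_eq_right]) simp
    finally show "(\<Sum>i<n. norm (h (v i) - h (u i))) < \<epsilon>" .
  qed
qed

lemma abs_continuous_on_ident: "abs_continuous_on a b (\<lambda>x::real. x)"
  unfolding abs_continuous_on_def
proof (intro allI impI)
  fix \<epsilon> :: real assume "\<epsilon> > 0"
  have "(\<Sum>i<n. norm (v i - u i)) = (\<Sum>i<n. v i - u i)"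
    if "\<forall>i<n. a \<le> u i \<and> u i \<le> v i \<and> v i \<le> b" for n :: nat and u v :: "nat \<Rightarrow> real"
    using that by (intro sum.cong) auto
  then show "\<exists>\<delta>>0. \<forall>(n::nat) u v. (\<forall>i<n. a \<le> u i \<and> u i \<le> v i \<and> v i \<le> b) \<and>
        disjoint_family_on (\<lambda>i. {u i<..<v i}) {..<n} \<and> (\<Sum>i<n. v i - u i) < \<delta>
        \<longrightarrow> (\<Sum>i<n. norm (v i - u i)) < \<epsilon>"
    using \<open>\<epsilon> > 0\<close> by (intro exI[of _ \<epsilon>]) auto
qed

lemma abs_continuous_on_add:
  assumes "abs_continuous_on a b f" "abs_continuous_on a b g"
  shows "abs_continuous_on a b (\<lambda>x. f x + g x)"
proof (rule abs_continuous_on_dominated[OF assms, of 1])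
  fix u v
  show "norm (f v + g v - (f u + g u)) \<le> 1 * (norm (f v - f u) + norm (g v - g u))"
    using norm_triangle_ineq[of "f v - f u" "g v - g u"] by (simp add: algebra_simps)
qed auto

lemma abs_continuous_on_diff:
  assumes "abs_continuous_on a b f" "abs_continuous_on a b g"
  shows "abs_continuous_on a b (\<lambda>x. f x - g x)"
proof (rule abs_continuous_on_dominated[OF assms, of 1])
  fix u v
  show "norm (f v - g v - (f u - g u)) \<le> 1 * (norm (f v - f u) + norm (g v - g u))"
    using norm_triangle_ineq4[of "f v - f u" "g v - g u"] by (simp add: algebra_simps)
qed auto

lemma abs_continuous_on_of_real:
  assumes "abs_continuous_on a b f"
  shows "abs_continuous_on a b (\<lambda>x. of_real (f x) :: 'a::real_normed_algebra_1)"
  by (rule abs_continuous_on_dominated[OF assms assms, of 1])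
     (simp_all add: norm_of_real flip: of_real_diff)

lemma abs_continuous_on_imp_continuous_on:
  assumes f: "abs_continuous_on a b f"
  shows "continuous_on {a..b} f"
  unfolding continuous_on_iff
proof (intro ballI allI impI)
  fix x \<epsilon> assume x: "x \<in> {a..b}" and "(\<epsilon>::real) > 0"
  obtain d where "d > 0" and d: "\<And>n u v.
        (\<forall>i<(n::nat). a \<le> u i \<and> u i \<le> v i \<and> v i \<le> b) \<and>
        disjoint_family_on (\<lambda>i. {u i<..<v i}) {..<n} \<and> (\<Sum>i<n. v i - u i) < d
        \<Longrightarrow> (\<Sum>i<n. norm (f (v i) - f (u i))) < \<epsilon>"
    using f \<open>\<epsilon> > 0\<close> unfolding abs_continuous_on_def by meson
  \<comment> \<open>The family consists of one interval, with endpoints x and y put in order by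
    \<open>min\<close> and \<open>max\<close>.\<close>
  have "dist (f y) (f x) < \<epsilon>" if "y \<in> {a..b}" "dist y x < d" for y
    using d[of 1 "\<lambda>_. min x y" "\<lambda>_. max x y"] that x
    by (auto simp: disjoint_family_on_def dist_norm min_def max_def norm_minus_commute abs_if
        split: if_splits)
  then show "\<exists>d>0. \<forall>y\<in>{a..b}. dist y x < d \<longrightarrow> dist (f y) (f x) < \<epsilon>"
    using \<open>d > 0\<close> by blast
qed

text \<open>Both factors are continuous, hence bounded on the compact interval, and the increment of
  the product splits into one increment of each factor times a bounded value.\<close>

lemma abs_continuous_on_mult:
  fixes f g :: "real \<Rightarrow> 'a::real_normed_algebra"
  assumes f: "abs_continuous_on a b f" and g: "abs_continuous_on a b g"
  shows "abs_continuous_on a b (\<lambda>x. f x * g x)"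
proof -
  have "bounded (f ` {a..b})" "bounded (g ` {a..b})"
    using f g by (auto intro!: compact_imp_bounded compact_continuous_image
        abs_continuous_on_imp_continuous_on)
  then obtain B1 B2 where B1: "\<And>x. x \<in> {a..b} \<Longrightarrow> norm (f x) \<le> B1"
      and B2: "\<And>x. x \<in> {a..b} \<Longrightarrow> norm (g x) \<le> B2"
    unfolding bounded_iff by blast
  define M where "M = max 0 (max B1 B2)"
  have M: "norm (f x) \<le> M" "norm (g x) \<le> M" if "x \<in> {a..b}" for x
    using B1[OF that] B2[OF that] by (auto simp: M_def)
  show ?thesis
  proof (rule abs_continuous_on_dominated[OF f g, of M])
    show "M \<ge> 0" by (simp add: M_def)
    fix u v assume uv: "a \<le> u" "u \<le> v" "v \<le> b"
    have "f v * g v - f u * g u = (f v - f u) * g v + f u * (g v - g u)"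
      by (simp add: algebra_simps)
    also have "norm \<dots> \<le> norm (f v - f u) * norm (g v) + norm (f u) * norm (g v - g u)"
      by (intro norm_triangle_mono norm_mult_ineq)
    also have "\<dots> \<le> norm (f v - f u) * M + M * norm (g v - g u)"
      using uv by (intro add_mono mult_left_mono mult_right_mono M) auto
    finally show "norm (f v * g v - f u * g u) \<le> M * (norm (f v - f u) + norm (g v - g u))"
      by (simp add: algebra_simps)
  qed
qed

text \<open>A bound on the continuous derivative is a Lipschitz constant, so the increments are
  dominated by those of the identity.\<close>

lemma abs_continuous_on_C1:
  assumes der: "\<And>x. x \<in> {a..b} \<Longrightarrow> (f has_vector_derivative f' x) (at x within {a..b})"
    and cont: "continuous_on {a..b} f'"
  shows "abs_continuous_on a b f"
proof -
  have "bounded (f' ` {a..b})"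
    using cont by (auto intro!: compact_imp_bounded compact_continuous_image)
  then obtain B where "B > 0" and B: "\<And>x. x \<in> {a..b} \<Longrightarrow> norm (f' x) \<le> B"
    unfolding bounded_pos by auto
  show ?thesis
  proof (rule abs_continuous_on_dominated[OF abs_continuous_on_ident abs_continuous_on_ident, of B])
    fix u v :: real assume uv: "a \<le> u" "u \<le> v" "v \<le> b"
    have "norm (f v - f u) \<le> B * norm (v - u)"
    proof (rule differentiable_bound[of "{a..b}" f "\<lambda>x h. h *\<^sub>R f' x"])
      show "onorm (\<lambda>h. h *\<^sub>R f' x) \<le> B" if "x \<in> {a..b}" for x
        using B[OF that] by (intro onorm_le) (auto simp: mult.commute[of B] mult_left_mono)
    qed (use der uv in \<open>auto simp: has_vector_derivative_def\<close>)
    then show "norm (f v - f u) \<le> B * (norm (v - u) + norm (v - u))"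
      using \<open>B > 0\<close> by (smt (verit) mult_left_mono norm_ge_zero)
  qed (use \<open>B > 0\<close> in auto)
qed

text \<open>A gauge argument: tags in the exceptional null set are controlled by absolute continuity
  (their intervals lie in an open set of small measure), all other tags by the derivative.\<close>
lemma abs_continuous_on_zero_derivative:
  assumes ab: "a \<le> b" and f: "abs_continuous_on a b f" and N: "negligible N"
    and der: "\<And>x. x \<in> {a..b} - N \<Longrightarrow> (f has_vector_derivative 0) (at x within {a..b})"
  shows "f b = f a"
proof -
  have "norm (f b - f a) \<le> 0 + \<epsilon>" if "\<epsilon> > 0" for \<epsilon> :: real
  proof -
    define \<eta> where "\<eta> = \<epsilon> / (2 * (b - a + 1))"
    have "\<eta> > 0" using that ab by (simp add: \<eta>_def)
    have \<eta>: "\<eta> * (b - a) \<le> \<epsilon> / 2" using that ab by (simp add: \<eta>_def field_simps)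
    obtain d where "d > 0" and d: "\<And>n u v.
        (\<forall>i<(n::nat). a \<le> u i \<and> u i \<le> v i \<and> v i \<le> b) \<and>
        disjoint_family_on (\<lambda>i. {u i<..<v i}) {..<n} \<and> (\<Sum>i<n. v i - u i) < d
        \<Longrightarrow> (\<Sum>i<n. norm (f (v i) - f (u i))) < \<epsilon> / 2"
      using f half_gt_zero[OF \<open>\<epsilon> > 0\<close>] unfolding abs_continuous_on_def by meson
    have "N \<in> null_sets lebesgue" using N by (simp add: negligible_iff_null_sets)
    then have Nm: "N \<in> sets lebesgue" "emeasure lebesgue N = 0"
      by (auto simp only: null_setsD1 null_setsD2)
    obtain T where T: "open T" "N \<subseteq> T" "T - N \<in> lmeasurable" "emeasure lebesgue (T - N) < ennreal d"
      using sets_lebesgue_outer_open[OF Nm(1) \<open>d > 0\<close>] by blast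
    have Tm: "T \<in> sets lebesgue" using \<open>open T\<close> by auto
    have "emeasure lebesgue T \<le> emeasure lebesgue (T - N) + emeasure lebesgue N"
      using T Nm Tm emeasure_subadditive[of "T - N" lebesgue N]
      by (simp add: Un_absorb2 fmeasurableD)
    then have Td: "emeasure lebesgue T < ennreal d"
      using T(4) Nm(2) by simp
    have "\<exists>e>0. \<forall>y\<in>{a..b}. \<bar>y - x\<bar> < e \<longrightarrow> norm (f y - f x) \<le> \<eta> * \<bar>y - x\<bar>"
      if "x \<in> {a..b} - N" for x
      using der[OF that] \<open>\<eta> > 0\<close>
      unfolding has_vector_derivative_def has_derivative_within_alt by auto
    then obtain e where e: "\<And>x. x \<in> {a..b} - N \<Longrightarrow> e x > 0"
      and e': "\<And>x y. x \<in> {a..b} - N \<Longrightarrow> y \<in> {a..b} \<Longrightarrow> \<bar>y - x\<bar> < e x \<Longrightarrow>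
          norm (f y - f x) \<le> \<eta> * \<bar>y - x\<bar>"
      by metis
    \<comment> \<open>A tag in \<open>N\<close> forces its interval into the small open set
      \<open>T\<close>; any other tag in the interval forces it into the ball where increments from
      the tag are at most \<open>\<eta>\<close> times the distance.\<close>
    define \<gamma> where "\<gamma> = (\<lambda>x. if x \<in> N then T else if x \<in> {a..b} then ball x (e x) else UNIV)"
    have "gauge \<gamma>"
      unfolding gauge_def \<gamma>_def using T e by auto
    then obtain p where p: "p tagged_division_of {a..b}" "\<gamma> fine p"
      using fine_division_exists_real by blast
    have fin: "finite p" using tagged_division_ofD(1)[OF p(1)] .
    have pK: "x \<in> K \<and> K = {Inf K..Sup K} \<and> Inf K \<le> x \<and> x \<le> Sup K \<and> a \<le> Inf K \<and> Sup K \<le> b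
        \<and> K \<subseteq> \<gamma> x" if xK: "(x, K) \<in> p" for x K
    proof -
      obtain u v where "K = cbox u v" using tagged_division_ofD(4)[OF p(1) xK] by blast
      moreover have "x \<in> K" "K \<subseteq> {a..b}"
        using tagged_division_ofD(2,3)[OF p(1) xK] by auto
      moreover have "K \<subseteq> \<gamma> x" using p(2) xK by (auto simp: fine_def)
      ultimately show ?thesis by (auto simp: box_real)
    qed
    define p1 where "p1 = {xK \<in> p. fst xK \<in> N}"
    define p2 where "p2 = {xK \<in> p. fst xK \<notin> N}"
    have p12: "p = p1 \<union> p2" "p1 \<inter> p2 = {}" "finite p1" "finite p2" "p1 \<subseteq> p" "p2 \<subseteq> p"
      using fin by (auto simp: p1_def p2_def)
    let ?D = "\<lambda>K. f (Sup K) - f (Inf K)"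
    \<comment> \<open>Tags off \<open>N\<close>: each increment is split at its tag and is at most
      \<open>\<eta>\<close> times the length of the piece; the lengths add up to
      \<open>b - a\<close>.\<close>
    have 2: "(\<Sum>xK\<in>p2. norm (?D (snd xK))) \<le> \<epsilon> / 2"
    proof -
      have "(\<Sum>xK\<in>p2. norm (?D (snd xK))) \<le> (\<Sum>xK\<in>p2. \<eta> * measure lborel (snd xK))"
      proof (intro sum_mono, clarsimp)
        fix x K assume xK: "(x, K) \<in> p2"
        then have *: "(x, K) \<in> p" "x \<notin> N" by (auto simp: p2_def)
        note k = pK[OF *(1)]
        have xab: "x \<in> {a..b} - N" using * k by auto
        have "Inf K \<in> K" "Sup K \<in> K" using k by (metis atLeastAtMost_iff order.trans order.refl)+
        then have "\<bar>Inf K - x\<bar> < e x" "\<bar>Sup K - x\<bar> < e x"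
          using k xab by (auto simp: \<gamma>_def dist_real_def abs_minus_commute subset_iff)
        then have "norm (f (Inf K) - f x) \<le> \<eta> * (x - Inf K)" "norm (f (Sup K) - f x) \<le> \<eta> * (Sup K - x)"
          using e'[OF xab, of "Inf K"] e'[OF xab, of "Sup K"] k by auto
        then have "norm ((f (Sup K) - f x) - (f (Inf K) - f x)) \<le> \<eta> * (Sup K - x) + \<eta> * (x - Inf K)"
          by (intro order.trans[OF norm_triangle_ineq4]) auto
        moreover have content: "measure lborel K = Sup K - Inf K"
          using k by (metis content_real order.trans)
        ultimately show "norm (f (Sup K) - f (Inf K)) \<le> \<eta> * measure lborel K"
          unfolding content by (simp add: algebra_simps)
      qed
      also have "\<dots> \<le> (\<Sum>xK\<in>p. \<eta> * measure lborel (snd xK))"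
        using fin p12 \<open>\<eta> > 0\<close> by (intro sum_mono2) auto
      also have "\<dots> = \<eta> * measure lborel {a..b}"
        using additive_content_tagged_division[of p a b] p(1)
        by (simp add: sum_distrib_left[symmetric] case_prod_beta)
      finally show ?thesis using \<eta> ab by simp
    qed
    \<comment> \<open>Tags in \<open>N\<close>: the pieces do not overlap and lie in
      \<open>T\<close>, so their total length is below \<open>d\<close>. They are enumerated by
      naturals to match the form of \<open>abs_continuous_on\<close>.\<close>
    have 1: "(\<Sum>xK\<in>p1. norm (?D (snd xK))) < \<epsilon> / 2"
    proof -
      obtain h where h: "bij_betw h {0..<card p1} p1"
        using ex_bij_betw_nat_finite[OF \<open>finite p1\<close>] by blast
      then have h': "bij_betw h {..<card p1} p1" by (simp add: atLeast0LessThan)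
      define K where "K = (\<lambda>i. snd (h i))"
      have hp: "h i \<in> p1" if "i < card p1" for i
        using h' that by (auto simp: bij_betw_def)
      then have hp': "(fst (h i), K i) \<in> p" "fst (h i) \<in> N" if "i < card p1" for i
        using that by (auto simp: K_def p1_def)
      have *: "a \<le> Inf (K i) \<and> Inf (K i) \<le> Sup (K i) \<and> Sup (K i) \<le> b" if "i < card p1" for i
        using pK[OF hp'(1)[OF that]] by linarith
      have int: "{Inf (K i)<..<Sup (K i)} = interior (K i)" if "i < card p1" for i
        using pK[OF hp'(1)[OF that]] by (metis interior_atLeastAtMost_real)
      have disj: "disjoint_family_on (\<lambda>i. {Inf (K i)<..<Sup (K i)}) {..<card p1}"
        unfolding disjoint_family_on_def
      proof (intro ballI impI)
        fix i j assume ij: "i \<in> {..<card p1}" "j \<in> {..<card p1}" "i \<noteq> j"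
        have "h i \<noteq> h j" using h' ij by (metis bij_betw_def inj_on_def)
        then have "(fst (h i), K i) \<noteq> (fst (h j), K j)" by (metis K_def prod.collapse)
        then have "interior (K i) \<inter> interior (K j) = {}"
          using tagged_division_ofD(5)[OF p(1)] hp' ij by blast
        then show "{Inf (K i)<..<Sup (K i)} \<inter> {Inf (K j)<..<Sup (K j)} = {}"
          using int ij by auto
      qed
      let ?U = "\<Union>i<card p1. {Inf (K i)<..<Sup (K i)}"
      have "emeasure lebesgue ?U = (\<Sum>i<card p1. emeasure lebesgue {Inf (K i)<..<Sup (K i)})"
        using disj by (intro sum_emeasure[symmetric]) auto
      also have "\<dots> = (\<Sum>i<card p1. ennreal (Sup (K i) - Inf (K i)))"
        using * by (intro sum.cong) auto
      also have "\<dots> = ennreal (\<Sum>i<card p1. Sup (K i) - Inf (K i))"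
        using * by (intro sum_ennreal) auto
      finally have "ennreal (\<Sum>i<card p1. Sup (K i) - Inf (K i)) = emeasure lebesgue ?U" ..
      also have "\<dots> \<le> emeasure lebesgue T"
      proof (rule emeasure_mono[OF _ Tm], safe)
        fix i y assume i: "i < card p1" and y: "y \<in> {Inf (K i)<..<Sup (K i)}"
        have "y \<in> K i" using y pK[OF hp'(1)[OF i]]
          by (metis greaterThanLessThan_iff atLeastAtMost_iff less_imp_le)
        then show "y \<in> T" using pK[OF hp'(1)[OF i]] hp'(2)[OF i] by (auto simp: \<gamma>_def)
      qed
      finally have "(\<Sum>i<card p1. Sup (K i) - Inf (K i)) < d"
        using Td \<open>d > 0\<close> by (meson ennreal_leI leI not_less order.strict_trans1)
      then have "(\<Sum>i<card p1. norm (?D (K i))) < \<epsilon> / 2"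
        using d[of "card p1" "\<lambda>i. Inf (K i)" "\<lambda>i. Sup (K i)"] disj * by auto
      also have "(\<Sum>i<card p1. norm (?D (K i))) = (\<Sum>xK\<in>p1. norm (?D (snd xK)))"
        unfolding K_def using sum.reindex_bij_betw[OF h', of "\<lambda>xK. norm (?D (snd xK))"] by simp
      finally show ?thesis .
    qed
    have "f b - f a = (\<Sum>xK\<in>p. ?D (snd xK))"
      using additive_tagged_division_1[OF ab p(1), of f] by (simp add: case_prod_beta)
    also have "norm \<dots> \<le> (\<Sum>xK\<in>p. norm (?D (snd xK)))" by (rule norm_sum)
    also have "\<dots> = (\<Sum>xK\<in>p1. norm (?D (snd xK))) + (\<Sum>xK\<in>p2. norm (?D (snd xK)))"
      using sum.union_disjoint[OF p12(3,4,2)] p12(1) by simp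
    finally show ?thesis using 1 2 by linarith
  qed
  then have "norm (f b - f a) \<le> 0" by (rule field_le_epsilon)
  then show ?thesis by simp
qed

lemma abs_continuous_on_subinterval:
  assumes "abs_continuous_on a b f" "a \<le> a'" "b' \<le> b"
  shows "abs_continuous_on a' b' f"
  unfolding abs_continuous_on_def
proof (intro allI impI)
  fix \<epsilon> :: real assume "\<epsilon> > 0"
  then obtain d where "d > 0" and d: "\<And>n u v.
        (\<forall>i<(n::nat). a \<le> u i \<and> u i \<le> v i \<and> v i \<le> b) \<and>
        disjoint_family_on (\<lambda>i. {u i<..<v i}) {..<n} \<and> (\<Sum>i<n. v i - u i) < d
        \<Longrightarrow> (\<Sum>i<n. norm (f (v i) - f (u i))) < \<epsilon>"
    using assms(1) unfolding abs_continuous_on_def by meson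
  show "\<exists>\<delta>>0. \<forall>(n::nat) u v. (\<forall>i<n. a' \<le> u i \<and> u i \<le> v i \<and> v i \<le> b') \<and>
        disjoint_family_on (\<lambda>i. {u i<..<v i}) {..<n} \<and> (\<Sum>i<n. v i - u i) < \<delta>
        \<longrightarrow> (\<Sum>i<n. norm (f (v i) - f (u i))) < \<epsilon>"
    using \<open>d > 0\<close> assms(2,3)
    by (intro exI[of _ d] conjI allI impI d) (auto intro: order.trans)
qed

section \<open>From equations almost everywhere or in the interior to equations on the closed
  interval\<close>

lemma has_vector_derivative_if_integral_eq:
  fixes f h :: "real \<Rightarrow> 'a::banach"
  assumes h: "continuous_on {a..b} h" and x: "x \<in> {a..b}"
    and eq: "\<And>x. x \<in> {a..b} \<Longrightarrow> f x = f a + integral {a..x} h"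
  shows "(f has_vector_derivative h x) (at x within {a..b})"
proof -
  have "((\<lambda>x. f a + integral {a..x} h) has_vector_derivative h x) (at x within {a..b})"
    using has_vector_derivative_add[OF has_vector_derivative_const
        integral_has_vector_derivative[OF h x]] by simp
  then show ?thesis
    using has_vector_derivative_transform[OF x eq] by simp
qed

text \<open>Subtracting the primitive of \<open>h\<close> from \<open>f\<close> leaves an absolutely
  continuous function with derivative 0 almost everywhere, hence a constant. So \<open>f\<close> is
  a primitive of a continuous function and is differentiable everywhere, one-sidedly at the
  ends.\<close>

lemma has_vector_derivative_AE_continuous:
  fixes f h :: "real \<Rightarrow> 'a::banach"
  assumes f: "abs_continuous_on a b f" and h: "continuous_on {a..b} h" and x: "x \<in> {a..b}"
    and ae: "AE x\<in>{a<..<b} in lebesgue. (f has_vector_derivative h x) (at x)"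
  shows "(f has_vector_derivative h x) (at x within {a..b})"
proof (rule has_vector_derivative_if_integral_eq[OF h x])
  fix x assume x: "x \<in> {a..b}"
  obtain N where N: "\<And>x. x \<notin> N \<Longrightarrow> x \<in> {a<..<b} \<Longrightarrow> (f has_vector_derivative h x) (at x)"
    and "N \<in> null_sets lebesgue"
    using AE_E3[OF ae] by auto
  \<comment> \<open>The hypothesis concerns the open interval only, so the endpoints join the null
    set.\<close>
  then have neg: "negligible (N \<union> {a, b})"
    by (simp add: negligible_iff_null_sets[symmetric])
  let ?F = "\<lambda>x. f x - integral {a..x} h"
  have I: "((\<lambda>u. integral {a..u} h) has_vector_derivative h x) (at x within {a..b})"
    if "x \<in> {a..b}" for x by (rule integral_has_vector_derivative[OF h that])
  have ac: "abs_continuous_on a b ?F"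
    by (intro abs_continuous_on_diff f abs_continuous_on_C1[OF I h])
  have "?F x = ?F a"
  proof (rule abs_continuous_on_zero_derivative[OF _ abs_continuous_on_subinterval[OF ac] neg])
    fix y assume y: "y \<in> {a..x} - (N \<union> {a, b})"
    then have y': "y \<in> {a<..<b}" "y \<notin> N" "y \<in> {a..b}" using x by auto
    have "(?F has_vector_derivative h y - h y) (at y within {a..b})"
      by (rule has_vector_derivative_diff[OF has_vector_derivative_at_within[OF N[OF y'(2,1)]] I[OF y'(3)]])
    then show "(?F has_vector_derivative 0) (at y within {a..x})"
      using x by (auto intro: has_vector_derivative_within_subset)
  qed (use x in auto)
  then show "f x = f a + integral {a..x} h" by (simp add: algebra_simps)
qed

text \<open>For \<open>l > 0\<close> no point of the interval is isolated in it, so one-sided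
  derivatives are unique.\<close>

lemma ideriv_eqI:
  assumes "l > 0" "x \<in> {0..l}" "(f has_vector_derivative D) (at x within {0..l})"
  shows "ideriv l f x = D"
  unfolding ideriv_def using vector_derivative_within_cbox[of 0 l x f D] assms by simp

lemma ideriv_has_vector_derivative:
  assumes "f differentiable_on {0..l}" "x \<in> {0..l}"
  shows "(f has_vector_derivative ideriv l f x) (at x within {0..l})"
  unfolding ideriv_def using assms by (simp add: vector_derivative_works[symmetric] differentiable_on_def)

lemma ideriv_has_vector_derivative_at:
  assumes "f differentiable at x" "x \<in> {0<..<l}"
  shows "(f has_vector_derivative ideriv l f x) (at x)"
proof -
  have "at x within {0..l} = at x" using assms(2) by (intro at_within_Icc_at) auto
  then show ?thesis
    unfolding ideriv_def using assms(1) by (simp add: vector_derivative_works[symmetric])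
qed

section \<open>Series of iterated integrals\<close>

text \<open>Termwise differentiation: the summable majorant makes the series of derivatives converge
  uniformly by the Weierstrass test.\<close>

lemma has_vector_derivative_suminf:
  fixes f :: "nat \<Rightarrow> real \<Rightarrow> 'a::banach"
  assumes der: "\<And>n x. x \<in> {a..b} \<Longrightarrow> (f n has_vector_derivative f' n x) (at x within {a..b})"
    and bound: "\<And>n x. x \<in> {a..b} \<Longrightarrow> norm (f' n x) \<le> B n" and "summable B"
    and f: "\<And>x. x \<in> {a..b} \<Longrightarrow> summable (\<lambda>n. f n x)" and x: "x \<in> {a..b}"
  shows "((\<lambda>x. \<Sum>n. f n x) has_vector_derivative (\<Sum>n. f' n x)) (at x within {a..b})"
proof -
  have ul: "uniform_limit {a..b} (\<lambda>n x. \<Sum>i<n. f' i x) (\<lambda>x. \<Sum>i. f' i x) sequentially"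
    using bound \<open>summable B\<close> by (intro Weierstrass_m_test) auto
  \<comment> \<open>The limit \<open>g\<close> is at first only some function with the right
    derivative; on the interval it is then identified with the pointwise sum.\<close>
  have "\<exists>g. \<forall>x\<in>{a..b}. (\<lambda>n. f n x) sums (g x) \<and>
      (g has_derivative (\<lambda>h. h *\<^sub>R (\<Sum>i. f' i x))) (at x within {a..b})"
  proof (rule has_derivative_series[where f' = "\<lambda>n x h. h *\<^sub>R f' n x", OF _ _ _ x])
    show "(f n has_derivative (\<lambda>h. h *\<^sub>R f' n x)) (at x within {a..b})"
      if "x \<in> {a..b}" for n x using der[OF that] by (simp add: has_vector_derivative_def)
    show "\<forall>\<^sub>F n in sequentially. \<forall>x\<in>{a..b}. \<forall>h.
        norm ((\<Sum>i<n. h *\<^sub>R f' i x) - h *\<^sub>R (\<Sum>i. f' i x)) \<le> e * norm h" if "e > 0" for e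
    proof (rule eventually_mono[OF uniform_limitD[OF ul that]], intro ballI allI)
      fix n x h assume *: "\<forall>x\<in>{a..b}. dist (\<Sum>i<n. f' i x) (\<Sum>i. f' i x) < e" and x: "x \<in> {a..b}"
      have "norm ((\<Sum>i<n. h *\<^sub>R f' i x) - h *\<^sub>R (\<Sum>i. f' i x))
          = \<bar>h\<bar> * dist (\<Sum>i<n. f' i x) (\<Sum>i. f' i x)"
        by (simp add: dist_norm scaleR_sum_right[symmetric] scaleR_diff_right[symmetric])
      also have "\<dots> \<le> \<bar>h\<bar> * e" using * x by (intro mult_left_mono) (auto intro: less_imp_le)
      finally show "norm ((\<Sum>i<n. h *\<^sub>R f' i x) - h *\<^sub>R (\<Sum>i. f' i x)) \<le> e * norm h"
        by (simp add: mult.commute)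
    qed
    show "(\<lambda>n. f n x) sums (\<Sum>n. f n x)" using f[OF x] by (rule summable_sums)
  qed auto
  then obtain g where g: "\<And>x. x \<in> {a..b} \<Longrightarrow> (\<lambda>n. f n x) sums (g x)"
    "\<And>x. x \<in> {a..b} \<Longrightarrow> (g has_vector_derivative (\<Sum>i. f' i x)) (at x within {a..b})"
    unfolding has_vector_derivative_def by blast
  show ?thesis
    using has_vector_derivative_transform[OF x _ g(2)[OF x], of "\<lambda>x. \<Sum>n. f n x"] g(1)
    by (simp add: sums_iff)
qed

text \<open>The iterated integrals and the Bessel and Struve coefficients all satisfy a bound of
  this shape, which makes their power series entire.\<close>

lemma summable_exp_bound:
  fixes a :: "nat \<Rightarrow> 'a::banach"
  assumes "\<And>n. norm (a n) \<le> C * K ^ n / fact n"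
  shows "summable a"
proof (rule summable_comparison_test)
  show "\<exists>N. \<forall>n\<ge>N. norm (a n) \<le> C * (inverse (fact n) * K ^ n)"
    using assms by (auto simp: field_simps)
  show "summable (\<lambda>n. C * (inverse (fact n) * K ^ n))"
    by (intro summable_mult summable_exp)
qed

lemma summable_exp_bound_power:
  fixes a :: "nat \<Rightarrow> complex"
  assumes "\<And>n. norm (a n) \<le> C * K ^ n / fact n"
  shows "summable (\<lambda>n. a n * s ^ n)"
proof (rule summable_exp_bound)
  fix n
  have "norm (a n * s ^ n) \<le> C * K ^ n / fact n * norm s ^ n"
    unfolding norm_mult norm_power by (intro mult_right_mono assms) auto
  then show "norm (a n * s ^ n) \<le> C * (K * norm s) ^ n / fact n"
    by (simp add: power_mult_distrib mult_ac)
qed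

lemma holomorphic_on_powser_everywhere:
  fixes a :: "nat \<Rightarrow> complex"
  assumes "\<And>s. summable (\<lambda>n. a n * s ^ n)"
  shows "(\<lambda>s. \<Sum>n. a n * s ^ n) holomorphic_on UNIV"
  using termdiffs_strong_converges_everywhere[OF assms]
  by (auto simp: holomorphic_on_def field_differentiable_def)

section \<open>Picard series for a two-by-two system\<close>

primrec iterated_integral :: "(real \<Rightarrow> real) \<Rightarrow> (real \<Rightarrow> real) \<Rightarrow> nat \<Rightarrow> real \<Rightarrow> real" where
  "iterated_integral w1 w2 0 = (\<lambda>x. 1)"
| "iterated_integral w1 w2 (Suc n) =
     (\<lambda>x. integral {0..x} (\<lambda>s. w2 s * integral {0..s} (\<lambda>t. w1 t * iterated_integral w1 w2 n t)))"

text \<open>Picard iteration for \<open>A' = s w\<^sub>2 B\<close>, \<open>B' = w\<^sub>1 A\<close>, \<open>A(0) = 1\<close>, \<open>B(0) = 0\<close>, sorted by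
  powers of \<open>s\<close>: the solution is \<open>A = even_series\<close>, \<open>B = odd_series\<close>.\<close>
definition even_series :: "(real \<Rightarrow> real) \<Rightarrow> (real \<Rightarrow> real) \<Rightarrow> complex \<Rightarrow> real \<Rightarrow> complex" where
  "even_series w1 w2 s x = (\<Sum>n. of_real (iterated_integral w1 w2 n x) * s ^ n)"

definition odd_series :: "(real \<Rightarrow> real) \<Rightarrow> (real \<Rightarrow> real) \<Rightarrow> complex \<Rightarrow> real \<Rightarrow> complex" where
  "odd_series w1 w2 s x =
     (\<Sum>n. of_real (integral {0..x} (\<lambda>t. w1 t * iterated_integral w1 w2 n t)) * s ^ n)"

context
  fixes w1 w2 :: "real \<Rightarrow> real" and l M :: real
  assumes w1: "continuous_on {0..l} w1" and w2: "continuous_on {0..l} w2"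
    and l: "l > 0"
    and M1: "\<And>x. x \<in> {0..l} \<Longrightarrow> \<bar>w1 x\<bar> \<le> M" and M2: "\<And>x. x \<in> {0..l} \<Longrightarrow> \<bar>w2 x\<bar> \<le> M"
begin

private abbreviation "u \<equiv> iterated_integral w1 w2"
private abbreviation "v \<equiv> \<lambda>n x. integral {0..x} (\<lambda>t. w1 t * u n t)"
private abbreviation "K \<equiv> M * l * M"

private lemma M_nonneg: "M \<ge> 0" "K \<ge> 0"
  using M1[of 0] l by auto

private lemma continuous_u: "continuous_on {0..l} (u n)"
  and continuous_v: "continuous_on {0..l} (v n)"
proof -
  have I: "continuous_on {0..l} (\<lambda>x. integral {0..x} f)" if "continuous_on {0..l} f"
    for f :: "real \<Rightarrow> real"
    using that by (intro indefinite_integral_continuous_1 integrable_continuous_real)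
  show u: "continuous_on {0..l} (u n)" for n
    by (induction n) (auto intro!: I continuous_intros w1 w2)
  show "continuous_on {0..l} (v n)"
    by (intro I continuous_intros w1 u)
qed

private lemma deriv_v:
  assumes "x \<in> {0..l}"
  shows "(v n has_vector_derivative w1 x * u n x) (at x within {0..l})"
  using assms by (intro integral_has_vector_derivative continuous_intros w1 continuous_u)

text \<open>The index shift in the recursion turns the derivative of \<open>u n\<close> into a
  multiple of \<open>v (n - 1)\<close>; \<open>u 0\<close> is constant.\<close>

private lemma deriv_u:
  assumes "x \<in> {0..l}"
  shows "(u n has_vector_derivative (case n of 0 \<Rightarrow> 0 | Suc m \<Rightarrow> w2 x * v m x)) (at x within {0..l})"
proof (cases n)
  case (Suc m)
  show ?thesis unfolding Suc using assms
    by (simp, intro integral_has_vector_derivative continuous_intros w2 continuous_v) 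
qed auto

text \<open>Of the two integrations in one step the inner one is estimated crudely, by a factor
  \<open>M * l\<close>, and the outer one exactly. The outer one yields the factor x / (n + 1) and
  hence the factorial; \<open>K\<close> collects the other factors.\<close>

private lemma bound_u: "x \<in> {0..l} \<Longrightarrow> \<bar>u n x\<bar> \<le> (K * x) ^ n / fact n"
  and bound_v: "x \<in> {0..l} \<Longrightarrow> \<bar>v n x\<bar> \<le> M * l * ((K * x) ^ n / fact n)"
proof -
  have v: "\<bar>v n x\<bar> \<le> M * l * ((K * x) ^ n / fact n)"
    if u: "\<And>x. x \<in> {0..l} \<Longrightarrow> \<bar>u n x\<bar> \<le> (K * x) ^ n / fact n" and x: "x \<in> {0..l}" for n x
  proof -
    have "norm (v n x) \<le> M * ((K * x) ^ n / fact n) * (x - 0)"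
    proof (rule integral_bound)
      show "continuous_on {0..x} (\<lambda>t. w1 t * u n t)"
        using x by (auto intro!: continuous_intros continuous_on_subset[OF w1]
            continuous_on_subset[OF continuous_u])
      show "norm (w1 t * u n t) \<le> M * ((K * x) ^ n / fact n)" if t: "t \<in> {0..x}" for t
      proof -
        have "\<bar>u n t\<bar> \<le> (K * t) ^ n / fact n" using t x by (intro u) auto
        also have "\<dots> \<le> (K * x) ^ n / fact n"
          using t M_nonneg by (intro divide_right_mono power_mono mult_left_mono) auto
        finally show ?thesis
          unfolding real_norm_def abs_mult
          using M1[of t] t x M_nonneg by (intro mult_mono) auto
      qed
    qed (use x in auto)
    also have "\<dots> \<le> M * ((K * x) ^ n / fact n) * l"
      using x M_nonneg by (intro mult_left_mono) auto
    finally show ?thesis by (simp add: mult_ac)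
  qed
  show u: "\<bar>u n x\<bar> \<le> (K * x) ^ n / fact n" if "x \<in> {0..l}" for n x
    using that
  proof (induction n arbitrary: x)
    case (Suc n)
    \<comment> \<open>The majorant of the integrand is the derivative of the bound to be
      proved.\<close>
    let ?g = "\<lambda>s. K ^ Suc n * s ^ n / fact n"
    have "((\<lambda>s. K ^ Suc n * s ^ Suc n / fact (Suc n)) has_vector_derivative ?g s) (at s within {0..x})"
      for s
      unfolding has_real_derivative_iff_has_vector_derivative[symmetric]
      by (rule derivative_eq_intros refl | simp)+
    then have "(?g has_integral (K ^ Suc n * x ^ Suc n / fact (Suc n) - K ^ Suc n * 0 ^ Suc n / fact (Suc n))) {0..x}"
      using Suc.prems by (intro fundamental_theorem_of_calculus) auto
    then have g: "?g integrable_on {0..x}" "integral {0..x} ?g = (K * x) ^ Suc n / fact (Suc n)"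
      by (auto simp: has_integral_iff power_mult_distrib)
    have "norm (u (Suc n) x) \<le> integral {0..x} ?g"
      unfolding iterated_integral.simps
    proof (rule integral_norm_bound_integral[OF _ g(1)])
      show "(\<lambda>s. w2 s * v n s) integrable_on {0..x}"
        using Suc.prems by (auto intro!: integrable_continuous_real continuous_intros
            continuous_on_subset[OF w2] continuous_on_subset[OF continuous_v])
      fix s assume s: "s \<in> {0..x}"
      then have s': "s \<in> {0..l}" using Suc.prems by auto
      have "norm (w2 s * v n s) \<le> M * (M * l * ((K * s) ^ n / fact n))"
        unfolding real_norm_def abs_mult
        using M2[OF s'] v[OF Suc.IH s'] M_nonneg by (intro mult_mono) auto
      then show "norm (w2 s * v n s) \<le> ?g s"
        by (simp add: power_mult_distrib mult_ac)
    qed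
    then show ?case using g by simp
  qed auto
  show "x \<in> {0..l} \<Longrightarrow> \<bar>v n x\<bar> \<le> M * l * ((K * x) ^ n / fact n)" by (rule v[OF u])
qed

private lemma bound_u': "x \<in> {0..l} \<Longrightarrow> \<bar>u n x\<bar> \<le> 1 * (K * l) ^ n / fact n"
  using M_nonneg bound_u[of x n]
  by (auto intro!: order.trans[OF bound_u] divide_right_mono power_mono mult_left_mono)

private lemma bound_v': "x \<in> {0..l} \<Longrightarrow> \<bar>v n x\<bar> \<le> M * l * (K * l) ^ n / fact n"
  unfolding times_divide_eq_right[symmetric] using M_nonneg l
  by (auto intro!: order.trans[OF bound_v] mult_left_mono divide_right_mono power_mono)

private lemma summable_u: "x \<in> {0..l} \<Longrightarrow> summable (\<lambda>n. complex_of_real (u n x) * s ^ n)"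
  by (rule summable_exp_bound_power[of _ 1 "K * l"]) (use bound_u'[of x] in simp)

private lemma summable_v: "x \<in> {0..l} \<Longrightarrow> summable (\<lambda>n. complex_of_real (v n x) * s ^ n)"
  by (rule summable_exp_bound_power[of _ "M * l" "K * l"]) (use bound_v'[of x] in simp)

lemma odd_series_has_vector_derivative:
  assumes x: "x \<in> {0..l}"
  shows "(odd_series w1 w2 s has_vector_derivative of_real (w1 x) * even_series w1 w2 s x) (at x within {0..l})"
proof -
  have "((\<lambda>x. \<Sum>n. of_real (v n x) * s ^ n) has_vector_derivative
      (\<Sum>n. of_real (w1 x * u n x) * s ^ n)) (at x within {0..l})"
  proof (rule has_vector_derivative_suminf[OF _ _ _ summable_v x])
    fix n x assume x: "x \<in> {0..l}"
    show "((\<lambda>x. complex_of_real (v n x) * s ^ n) has_vector_derivative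
        complex_of_real (w1 x * u n x) * s ^ n) (at x within {0..l})"
      by (intro has_vector_derivative_mult_left has_vector_derivative_of_real
          deriv_v[folded has_real_derivative_iff_has_vector_derivative] x)
    have "norm (complex_of_real (w1 x * u n x) * s ^ n) = \<bar>w1 x\<bar> * \<bar>u n x\<bar> * norm s ^ n"
      by (simp add: norm_mult norm_power abs_mult)
    also have "\<dots> \<le> M * (1 * (K * l) ^ n / fact n) * norm s ^ n"
      using M_nonneg by (intro mult_mono mult_right_mono M1 bound_u' x) auto
    finally show "norm (complex_of_real (w1 x * u n x) * s ^ n) \<le> M * (K * l * norm s) ^ n / fact n"
      by (simp add: power_mult_distrib mult_ac)
  next
    show "summable (\<lambda>n. M * (K * l * norm s) ^ n / fact n)"
      using M_nonneg l by (intro summable_exp_bound[of _ M "K * l * norm s"]) auto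
  qed
  moreover have "(\<Sum>n. of_real (w1 x * u n x) * s ^ n) = of_real (w1 x) * even_series w1 w2 s x"
    unfolding even_series_def
    by (subst suminf_mult[OF summable_u[OF x], symmetric]) (simp add: mult_ac)
  ultimately show ?thesis by (simp add: odd_series_def[abs_def])
qed

lemma even_series_has_vector_derivative:
  assumes x: "x \<in> {0..l}"
  shows "(even_series w1 w2 s has_vector_derivative s * of_real (w2 x) * odd_series w1 w2 s x) (at x within {0..l})"
proof -
  let ?d = "\<lambda>n x. case n of 0 \<Rightarrow> 0 | Suc m \<Rightarrow> w2 x * v m x"
  \<comment> \<open>The majorant vanishes for the constant term and otherwise comes from the bound
    on the preceding \<open>v m\<close>.\<close>
  let ?B = "\<lambda>n. case n of 0 \<Rightarrow> 0 | Suc m \<Rightarrow> M * (M * l) * norm s * (K * l * norm s) ^ m / fact m"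
  have "((\<lambda>x. \<Sum>n. of_real (u n x) * s ^ n) has_vector_derivative
      (\<Sum>n. of_real (?d n x) * s ^ n)) (at x within {0..l})"
  proof (rule has_vector_derivative_suminf[where B = ?B, OF _ _ _ summable_u x])
    fix n x assume x: "x \<in> {0..l}"
    show "((\<lambda>x. complex_of_real (u n x) * s ^ n) has_vector_derivative
        complex_of_real (?d n x) * s ^ n) (at x within {0..l})"
      by (intro has_vector_derivative_mult_left has_vector_derivative_of_real
          deriv_u[folded has_real_derivative_iff_has_vector_derivative] x)
    show "norm (complex_of_real (?d n x) * s ^ n) \<le> ?B n"
    proof (cases n)
      case (Suc m)
      have "norm (complex_of_real (?d n x) * s ^ n) = \<bar>w2 x\<bar> * \<bar>v m x\<bar> * norm s ^ n"
        by (simp add: norm_mult norm_power abs_mult Suc)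
      also have "\<dots> \<le> M * (M * l * (K * l) ^ m / fact m) * norm s ^ n"
        using M_nonneg by (intro mult_mono mult_right_mono M2 bound_v' x) auto
      finally show ?thesis by (simp add: Suc power_mult_distrib mult_ac)
    qed simp
  next
    have "summable (\<lambda>n. ?B (Suc n))"
      using M_nonneg l by (intro summable_exp_bound[of _ "M * (M * l) * norm s" "K * l * norm s"]) auto
    then show "summable ?B" by (subst (asm) summable_Suc_iff)
  qed
  moreover have "(\<Sum>n. of_real (?d n x) * s ^ n) = s * of_real (w2 x) * odd_series w1 w2 s x"
  proof -
    \<comment> \<open>The term with index 0 vanishes; shifting the index past it pulls out one
      factor \<open>s\<close>.\<close>
    have "(\<lambda>n. complex_of_real (?d (Suc n) x) * s ^ Suc n) sums (s * of_real (w2 x) * odd_series w1 w2 s x)"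
      using sums_mult[OF summable_sums[OF summable_v[OF x]], of "s * of_real (w2 x)" s]
      by (simp add: odd_series_def mult_ac)
    then have "(\<lambda>n. complex_of_real (?d n x) * s ^ n) sums (s * of_real (w2 x) * odd_series w1 w2 s x)"
      by (subst (asm) sums_Suc_iff) simp
    then show ?thesis by (simp add: sums_iff)
  qed
  ultimately show ?thesis by (simp add: even_series_def[abs_def])
qed

lemma holomorphic_series:
  assumes "x \<in> {0..l}"
  shows "(\<lambda>s. even_series w1 w2 s x) holomorphic_on UNIV"
    and "(\<lambda>s. odd_series w1 w2 s x) holomorphic_on UNIV"
  unfolding even_series_def odd_series_def
  using assms by (auto intro!: holomorphic_on_powser_everywhere summable_u summable_v)

end

lemma even_series_at_0: "even_series w1 w2 s 0 = 1"
proof -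
  have "complex_of_real (iterated_integral w1 w2 n 0) * s ^ n = (if n = 0 then 1 else 0)" for n
    by (cases n) auto
  then show ?thesis
    unfolding even_series_def using sums_single[of 0 "\<lambda>_. 1::complex"] by (simp add: sums_iff)
qed

lemma odd_series_at_0: "odd_series w1 w2 s 0 = 0"
  by (simp add: odd_series_def)

lemma even_series_0: "even_series w1 w2 0 x = 1"
  unfolding even_series_def by (subst powser_zero) simp

section \<open>The impedance\<close>

text \<open>Both series are taken at argument \<open>2 * w\<close>, which cancels the halving in
  their definitions. After a factor w (Bessel) or w^2 (Struve) is split off, only powers of s = w^2
  remain.\<close>

definition Bessel_coeff :: "nat \<Rightarrow> complex" where
  "Bessel_coeff m = (-1) ^ m / (fact m * fact (m + 1))"

definition Struve_coeff :: "nat \<Rightarrow> complex" where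
  "Struve_coeff m = (-1) ^ m / (Gamma (of_nat m + 3 / 2) * Gamma (of_nat (m + 1) + 3 / 2))"

definition Bessel_series :: "complex \<Rightarrow> complex" where
  "Bessel_series s = (\<Sum>m. Bessel_coeff m * s ^ m)"

definition Struve_series :: "complex \<Rightarrow> complex" where
  "Struve_series s = (\<Sum>m. Struve_coeff m * s ^ m)"

lemma of_nat_plus_3_2_not_nonpos: "of_nat m + 3 / 2 \<notin> (\<int>\<^sub>\<le>\<^sub>0 :: complex set)"
proof
  assume "of_nat m + 3 / 2 \<in> (\<int>\<^sub>\<le>\<^sub>0 :: complex set)"
  then obtain n where "of_nat m + 3 / 2 = - (of_nat n :: complex)"
    by (auto elim!: nonpos_Ints_cases')
  then have "Re (of_nat m + 3 / 2) = Re (- (of_nat n :: complex))" by simp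
  then show False by simp
qed

text \<open>The functional equation multiplies by m + 3/2, whose modulus is at least m + 1, so the
  growth is at least factorial.\<close>

lemma norm_Gamma_ge: "norm (Gamma (of_nat m + 3 / 2 :: complex)) \<ge> fact m * norm (Gamma (3 / 2 :: complex))"
proof (induction m)
  case (Suc m)
  have "Gamma (of_nat (Suc m) + 3 / 2 :: complex) = (of_nat m + 3 / 2) * Gamma (of_nat m + 3 / 2)"
    using Gamma_plus1[OF of_nat_plus_3_2_not_nonpos[of m]] by (simp add: algebra_simps)
  moreover have "norm (of_nat m + 3 / 2 :: complex) \<ge> real (Suc m)"
    using complex_Re_le_cmod[of "of_nat m + 3 / 2"] by simp
  then have "real (Suc m) * (fact m * norm (Gamma (3 / 2 :: complex)))
      \<le> norm (of_nat m + 3 / 2 :: complex) * norm (Gamma (of_nat m + 3 / 2 :: complex))"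
    by (intro mult_mono Suc.IH) auto
  ultimately show ?case
    by (simp only: norm_mult fact_Suc mult.assoc of_nat_fact of_nat_mult)
qed simp

lemma norm_Bessel_coeff_le: "norm (Bessel_coeff m) \<le> 1 * 1 ^ m / fact m"
proof -
  have "norm (Bessel_coeff m) = 1 / (fact m * fact (m + 1))"
    by (simp add: Bessel_coeff_def norm_divide norm_mult norm_power del: fact_Suc)
  also have "\<dots> \<le> 1 / fact m"
    using fact_ge_1[of "m + 1", where 'a = real] by (intro divide_left_mono) auto
  finally show ?thesis by simp
qed

text \<open>One Gamma factor supplies the factorial; the other is only bounded below by the modulus
  of Gamma(3/2), which is not zero.\<close>

lemma norm_Struve_coeff_le:
  "norm (Struve_coeff m) \<le> 1 / (norm (Gamma (3 / 2 :: complex)))\<^sup>2 * 1 ^ m / fact m"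
proof -
  define g where "g = norm (Gamma (3 / 2 :: complex))"
  have "Gamma (3 / 2 :: complex) \<noteq> 0"
    using of_nat_plus_3_2_not_nonpos[of 0] by (simp add: Gamma_eq_zero_iff)
  then have g: "g > 0" by (simp add: g_def)
  have "1 * g \<le> fact (m + 1) * g"
    using g fact_ge_1[of "m + 1", where 'a = real] by (intro mult_right_mono) auto
  also have "\<dots> \<le> norm (Gamma (of_nat (m + 1) + 3 / 2 :: complex))"
    using norm_Gamma_ge[of "m + 1"] by (simp add: g_def)
  finally have "fact m * g * g
      \<le> norm (Gamma (of_nat m + 3 / 2 :: complex)) * norm (Gamma (of_nat (m + 1) + 3 / 2 :: complex))"
    using norm_Gamma_ge[of m] g by (intro mult_mono) (auto simp: g_def)
  then have "norm (Struve_coeff m) \<le> 1 / (fact m * g * g)"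
    using g unfolding Struve_coeff_def norm_divide norm_mult norm_power
    by (intro frac_le) auto
  then show ?thesis by (simp add: g_def power2_eq_square mult_ac)
qed

lemma summable_Bessel: "summable (\<lambda>m. Bessel_coeff m * s ^ m)"
  by (rule summable_exp_bound_power norm_Bessel_coeff_le)+

lemma summable_Struve: "summable (\<lambda>m. Struve_coeff m * s ^ m)"
  by (rule summable_exp_bound_power norm_Struve_coeff_le)+

lemma holomorphic_Bessel_series: "Bessel_series holomorphic_on UNIV"
  unfolding Bessel_series_def[abs_def] by (intro holomorphic_on_powser_everywhere summable_Bessel)

lemma holomorphic_Struve_series: "Struve_series holomorphic_on UNIV"
  unfolding Struve_series_def[abs_def] by (intro holomorphic_on_powser_everywhere summable_Struve)

lemma Struve_series_0: "Struve_series 0 \<noteq> 0"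
  using of_nat_plus_3_2_not_nonpos[of 0] of_nat_plus_3_2_not_nonpos[of 1]
  unfolding Struve_series_def by (subst powser_zero) (simp add: Struve_coeff_def Gamma_eq_zero_iff)

lemma Bessel_J_1_eq: "Bessel_J 1 (2 * w) = w * Bessel_series (w\<^sup>2)"
proof -
  have pow: "w ^ (2 * m + 1) = w * (w\<^sup>2) ^ m" for m
    by (simp add: power_mult)
  have "Bessel_J 1 (2 * w) = (\<Sum>m. w * (Bessel_coeff m * (w\<^sup>2) ^ m))"
    unfolding Bessel_J_def Bessel_coeff_def
      nonzero_mult_div_cancel_left[OF zero_neq_numeral[symmetric]] pow by (simp only: mult_ac)
  also have "\<dots> = w * Bessel_series (w\<^sup>2)"
    unfolding Bessel_series_def by (rule suminf_mult[OF summable_Bessel])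
  finally show ?thesis .
qed

lemma Struve_H_1_eq: "Struve_H 1 (2 * w) = w\<^sup>2 * Struve_series (w\<^sup>2)"
proof -
  have pow: "w ^ (2 * m + 1 + 1) = w\<^sup>2 * (w\<^sup>2) ^ m" for m
    by (simp add: power_mult power2_eq_square mult.assoc)
  have "Struve_H 1 (2 * w) = (\<Sum>m. w\<^sup>2 * (Struve_coeff m * (w\<^sup>2) ^ m))"
    unfolding Struve_H_def Struve_coeff_def
      nonzero_mult_div_cancel_left[OF zero_neq_numeral[symmetric]] pow by (simp only: mult_ac)
  also have "\<dots> = w\<^sup>2 * Struve_series (w\<^sup>2)"
    unfolding Struve_series_def by (rule suminf_mult[OF summable_Struve])
  finally show ?thesis .
qed

lemma holomorphic_on_UNIV_compose:
  assumes "f holomorphic_on UNIV" "g holomorphic_on UNIV"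
  shows "(\<lambda>x. g (f x)) holomorphic_on UNIV"
  using holomorphic_on_compose_gen[OF assms] by (simp add: o_def)

lemma holomorphic_impedance_series:
  "(\<lambda>k. 1 - Bessel_series ((k * a)\<^sup>2) + \<i> * (k * a) * Struve_series ((k * a)\<^sup>2)) holomorphic_on UNIV"
  by (intro holomorphic_intros holomorphic_on_UNIV_compose[OF _ holomorphic_Bessel_series]
      holomorphic_on_UNIV_compose[OF _ holomorphic_Struve_series])

text \<open>For k other than 0 the denominator cancels against the factor split off from each
  series. The right-hand side is entire, so its value is the limit chosen by
  \<open>remove_sings\<close>, also at 0.\<close>

lemma impedance_eq:
  assumes "r l > 0"
  shows "impedance l r k = 1 - Bessel_series ((k * of_real (r l))\<^sup>2)
           + \<i> * (k * of_real (r l)) * Struve_series ((k * of_real (r l))\<^sup>2)" (is "_ = ?Z k")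
  unfolding impedance_def
proof (rule remove_sings_eqI)
  let ?f = "\<lambda>k. 1 - Bessel_J 1 (2 * k * of_real (r l)) / (k * of_real (r l))
                         + \<i> * (Struve_H 1 (2 * k * of_real (r l)) / (k * of_real (r l)))"
  have eq: "?f k = ?Z k" if "k \<noteq> 0" for k
    using that assms Bessel_J_1_eq[of "k * of_real (r l)"] Struve_H_1_eq[of "k * of_real (r l)"]
    by (simp add: power2_eq_square mult.assoc)
  have "isCont ?Z k"
    using holomorphic_on_imp_continuous_on[OF holomorphic_impedance_series]
    by (simp add: continuous_on_eq_continuous_at)
  then have "?Z \<midarrow>k\<rightarrow> ?Z k" by (rule isContD)
  moreover have "eventually (\<lambda>w. ?f w = ?Z w) (at k)"
    using eventually_neq_at_within[of 0 k UNIV] by (rule eventually_mono) (rule eq)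
  ultimately show "?f \<midarrow>k\<rightarrow> ?Z k"
    using tendsto_cong[of ?f ?Z "at k"] by blast
qed

lemma holomorphic_impedance:
  assumes "r l > 0"
  shows "impedance l r holomorphic_on UNIV"
  using holomorphic_impedance_series[of "of_real (r l)"] impedance_eq[of r l] assms
  by (simp add: fun_eq_iff cong: holomorphic_cong)

text \<open>The odd part of the impedance is \<open>\<i> w\<close> times a function of \<open>w\<^sup>2\<close> that does not vanish at 0.\<close>
lemma impedance_nonzero:
  assumes "r l > 0"
  obtains k where "impedance l r k \<noteq> 0"
proof -
  have "\<exists>k. impedance l r k \<noteq> 0"
  proof (rule ccontr)
    assume "\<nexists>k. impedance l r k \<noteq> 0"
    \<comment> \<open>The Bessel part is even in k and drops out of this difference.\<close>
    then have "impedance l r k - impedance l r (-k) = 0" for k by simp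
    then have "Struve_series ((k * of_real (r l))\<^sup>2) = 0" if "k \<noteq> 0" for k
      using that assms unfolding impedance_eq[of r l, OF assms] by fastforce
    then have 0: "Struve_series (w\<^sup>2) = 0" if "w \<noteq> 0" for w
      using that assms by (metis divide_eq_0_iff less_numeral_extra(3) nonzero_eq_divide_eq of_real_eq_0_iff)
    \<comment> \<open>Every nonzero s is the square of a nonzero number.\<close>
    then have "Struve_series s = 0" if "s \<noteq> 0" for s
      using 0[of "csqrt s"] that by simp
    then have "eventually (\<lambda>s. Struve_series s = 0) (at 0)"
      by (auto simp: eventually_at_filter)
    then have "Struve_series \<midarrow>0\<rightarrow> 0" by (rule tendsto_eventually)
    moreover have "isCont Struve_series 0"
      using holomorphic_on_imp_continuous_on[OF holomorphic_Struve_series]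
      by (simp add: continuous_on_eq_continuous_at)
    then have "Struve_series \<midarrow>0\<rightarrow> Struve_series 0" by (rule isContD)
    ultimately have "Struve_series 0 = 0" by (rule LIM_unique[symmetric])
    then show False using Struve_series_0 by simp
  qed
  then show ?thesis using that by blast
qed

text \<open>A meromorphic function on the plane either equals 0 off a sparse set or avoids 0 off a
  sparse set. Continuity at \<open>z\<close> excludes the first case.\<close>

lemma holomorphic_nonzero_cosparse:
  assumes f: "f holomorphic_on UNIV" and "f z \<noteq> 0"
  shows "\<forall>\<^sub>\<approx>k\<in>UNIV. f k \<noteq> 0"
proof -
  have an: "f analytic_on UNIV" using f by (simp add: analytic_on_open)
  have "\<not> (\<forall>\<^sub>\<approx>k\<in>UNIV. f k = 0)"
  proof
    assume "\<forall>\<^sub>\<approx>k\<in>UNIV. f k = 0"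
    then have "eventually (\<lambda>k. f k = 0) (at z)" by (simp add: eventually_cosparse_open_eq)
    moreover have "isCont f z"
      using holomorphic_on_imp_continuous_on[OF f] by (simp add: continuous_on_eq_continuous_at)
    then have "eventually (\<lambda>k. f k \<noteq> 0) (at z)"
      using assms(2) by (metis isContD tendsto_imp_eventually_ne)
    ultimately have "eventually (\<lambda>_. False) (at z)" by eventually_elim auto
    then show False by simp
  qed
  then show ?thesis
    using meromorphic_imp_constant_or_avoid[OF analytic_on_imp_meromorphic_on[OF an], of 0] by auto
qed

section \<open>The canonical system\<close>

locale vocal_tract =
  fixes l :: real and r :: "real \<Rightarrow> real"
  assumes l: "l > 0" and A: "class_A l r"
begin

abbreviation r' :: "real \<Rightarrow> real" where "r' \<equiv> ideriv l r"

lemma r_pos: "x \<in> {0..l} \<Longrightarrow> r x > 0"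
  and r_deriv: "x \<in> {0..l} \<Longrightarrow> (r has_vector_derivative r' x) (at x within {0..l})"
  and r'_cont: "continuous_on {0..l} r'" and r'_ac: "abs_continuous_on 0 l r'"
  and r'_ae: "AE x\<in>{0<..<l} in lebesgue. r' differentiable (at x)"
  and r_cont: "continuous_on {0..l} r"
  and r_nonzero: "x \<in> {0..l} \<Longrightarrow> r x \<noteq> 0"
  using A by (force simp: class_A_def intro: ideriv_has_vector_derivative
      differentiable_imp_continuous_on)+

text \<open>The equations are imposed at every point, one-sidedly at the ends. This suits class A
  because only \<open>r\<close>, and neither of its derivatives, enters the coefficients.\<close>

definition canonical_sol :: "complex \<Rightarrow> (real \<Rightarrow> complex) \<Rightarrow> (real \<Rightarrow> complex) \<Rightarrow> bool" where
  "canonical_sol k P V \<longleftrightarrow> (\<forall>x\<in>{0..l}.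
     (P has_vector_derivative V x / of_real ((r x)\<^sup>2)) (at x within {0..l}) \<and>
     (V has_vector_derivative - (k\<^sup>2 * of_real ((r x)\<^sup>2) * P x)) (at x within {0..l}))"

lemma canonical_solD:
  assumes "canonical_sol k P V" "x \<in> {0..l}"
  shows "(P has_vector_derivative V x / of_real ((r x)\<^sup>2)) (at x within {0..l})"
    and "(V has_vector_derivative - (k\<^sup>2 * of_real ((r x)\<^sup>2) * P x)) (at x within {0..l})"
  using assms by (auto simp: canonical_sol_def)

lemma r_deriv_complex:
  assumes "x \<in> {0..l}"
  shows "((\<lambda>x. complex_of_real (r x)) has_vector_derivative of_real (r' x)) (at x within {0..l})"
  by (rule has_vector_derivative_of_real[OF r_deriv[OF assms, folded has_real_derivative_iff_has_vector_derivative]])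

lemma inverse_r_deriv:
  assumes "x \<in> {0..l}"
  shows "((\<lambda>x. complex_of_real (inverse (r x))) has_vector_derivative
      of_real (- (inverse (r x) * r' x * inverse (r x)))) (at x within {0..l})"
  by (intro has_vector_derivative_of_real DERIV_inverse'[OF
        r_deriv[OF assms, folded has_real_derivative_iff_has_vector_derivative]] r_nonzero assms)

lemma canonical_sol_continuous:
  assumes "canonical_sol k P V"
  shows "continuous_on {0..l} P" "continuous_on {0..l} V"
  by (rule continuous_on_vector_derivative, erule canonical_solD[OF assms])+

lemma canonical_sol_lincomb:
  assumes "canonical_sol k P1 V1" "canonical_sol k P2 V2"
  shows "canonical_sol k (\<lambda>x. a * P1 x + b * P2 x) (\<lambda>x. a * V1 x + b * V2 x)"
  unfolding canonical_sol_def
proof (intro ballI conjI)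
  fix x assume x: "x \<in> {0..l}"
  note d = canonical_solD[OF assms(1) x] canonical_solD[OF assms(2) x]
  have "((\<lambda>x. a * P1 x + b * P2 x) has_vector_derivative
      a * (V1 x / of_real ((r x)\<^sup>2)) + b * (V2 x / of_real ((r x)\<^sup>2))) (at x within {0..l})"
    by (intro has_vector_derivative_add has_vector_derivative_mult_right d)
  then show "((\<lambda>x. a * P1 x + b * P2 x) has_vector_derivative
      (a * V1 x + b * V2 x) / of_real ((r x)\<^sup>2)) (at x within {0..l})"
    by (simp add: add_divide_distrib)
  have "((\<lambda>x. a * V1 x + b * V2 x) has_vector_derivative
      a * (- (k\<^sup>2 * of_real ((r x)\<^sup>2) * P1 x)) + b * (- (k\<^sup>2 * of_real ((r x)\<^sup>2) * P2 x))) (at x within {0..l})"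
    by (intro has_vector_derivative_add has_vector_derivative_mult_right d)
  then show "((\<lambda>x. a * V1 x + b * V2 x) has_vector_derivative
      - (k\<^sup>2 * of_real ((r x)\<^sup>2) * (a * P1 x + b * P2 x))) (at x within {0..l})"
    by (simp add: algebra_simps)
qed

text \<open>The coefficient matrix has trace 0, so the terms in the derivative of the determinant
  cancel in pairs.\<close>

lemma canonical_wronskian:
  assumes "canonical_sol k P1 V1" "canonical_sol k P2 V2"
    and x: "x \<in> {0..l}" and y: "y \<in> {0..l}"
  shows "P1 x * V2 x - V1 x * P2 x = P1 y * V2 y - V1 y * P2 y"
proof -
  let ?W = "\<lambda>x. P1 x * V2 x - V1 x * P2 x"
  have "(?W has_vector_derivative 0) (at x within {0..l})" if x: "x \<in> {0..l}" for x
  proof -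
    note d = canonical_solD[OF assms(1) x] canonical_solD[OF assms(2) x]
    have "(?W has_vector_derivative
       (P1 x * (- (k\<^sup>2 * of_real ((r x)\<^sup>2) * P2 x)) + V1 x / of_real ((r x)\<^sup>2) * V2 x) -
       (V1 x * (V2 x / of_real ((r x)\<^sup>2)) + - (k\<^sup>2 * of_real ((r x)\<^sup>2) * P1 x) * P2 x)) (at x within {0..l})"
      by (intro has_vector_derivative_diff has_vector_derivative_mult d)
    then show ?thesis by (simp add: algebra_simps)
  qed
  then obtain c where "\<And>x. x \<in> {0..l} \<Longrightarrow> ?W x = c"
    using has_vector_derivative_zero_constant[of "{0..l}" ?W] by blast
  then show ?thesis using x y by simp
qed

lemma area_bounds:
  obtains M where "\<And>x. x \<in> {0..l} \<Longrightarrow> \<bar>(r x)\<^sup>2\<bar> \<le> M" "\<And>x. x \<in> {0..l} \<Longrightarrow> \<bar>1 / (r x)\<^sup>2\<bar> \<le> M"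
proof -
  have "bounded ((\<lambda>x. (r x)\<^sup>2) ` {0..l})" "bounded ((\<lambda>x. 1 / (r x)\<^sup>2) ` {0..l})"
    using r_cont r_nonzero by (auto intro!: compact_imp_bounded compact_continuous_image continuous_intros)
  then obtain M1 M2 where "\<And>x. x \<in> {0..l} \<Longrightarrow> \<bar>(r x)\<^sup>2\<bar> \<le> M1" "\<And>x. x \<in> {0..l} \<Longrightarrow> \<bar>1 / (r x)\<^sup>2\<bar> \<le> M2"
    unfolding bounded_iff image_iff real_norm_def by blast
  then show ?thesis
    using that[of "max M1 M2"] by (meson max.coboundedI1 max.coboundedI2)
qed

section \<open>The fundamental solutions\<close>

text \<open>For constant radius 1 and nonzero k these are cos(kx), -k sin(kx), sin(kx)/k and
  cos(kx). With s = -k^2 the first pair is P = A, V = s B in the Picard system; for the second pair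
  the weights are exchanged and P = B, V = A.\<close>

definition "cosP k = even_series (\<lambda>x. (r x)\<^sup>2) (\<lambda>x. 1 / (r x)\<^sup>2) (- k\<^sup>2)"
definition "cosV k = (\<lambda>x. - k\<^sup>2 * odd_series (\<lambda>x. (r x)\<^sup>2) (\<lambda>x. 1 / (r x)\<^sup>2) (- k\<^sup>2) x)"
definition "sinP k = odd_series (\<lambda>x. 1 / (r x)\<^sup>2) (\<lambda>x. (r x)\<^sup>2) (- k\<^sup>2)"
definition "sinV k = even_series (\<lambda>x. 1 / (r x)\<^sup>2) (\<lambda>x. (r x)\<^sup>2) (- k\<^sup>2)"

lemma fundamental_at_0: "cosP k 0 = 1" "cosV k 0 = 0" "sinP k 0 = 0" "sinV k 0 = 1"
  by (simp_all add: cosP_def cosV_def sinP_def sinV_def even_series_at_0 odd_series_at_0)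

lemma area_cont: "continuous_on {0..l} (\<lambda>x. (r x)\<^sup>2)" "continuous_on {0..l} (\<lambda>x. 1 / (r x)\<^sup>2)"
  using r_cont r_pos by (force intro!: continuous_intros)+

lemma canonical_sol_cos: "canonical_sol k (cosP k) (cosV k)"
  unfolding canonical_sol_def
proof (intro ballI conjI)
  fix x assume x: "x \<in> {0..l}"
  obtain M where M: "\<And>x. x \<in> {0..l} \<Longrightarrow> \<bar>(r x)\<^sup>2\<bar> \<le> M" "\<And>x. x \<in> {0..l} \<Longrightarrow> \<bar>1 / (r x)\<^sup>2\<bar> \<le> M"
    using area_bounds by blast
  show "(cosP k has_vector_derivative cosV k x / of_real ((r x)\<^sup>2)) (at x within {0..l})"
    using even_series_has_vector_derivative[OF area_cont l M x, of "- k\<^sup>2"]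
    by (simp add: cosP_def cosV_def)
  show "(cosV k has_vector_derivative - (k\<^sup>2 * of_real ((r x)\<^sup>2) * cosP k x)) (at x within {0..l})"
    using has_vector_derivative_mult_right[OF odd_series_has_vector_derivative[OF area_cont l M x, of "- k\<^sup>2"], of "- k\<^sup>2"]
    by (simp add: cosP_def cosV_def mult.assoc)
qed

lemma canonical_sol_sin: "canonical_sol k (sinP k) (sinV k)"
  unfolding canonical_sol_def
proof (intro ballI conjI)
  fix x assume x: "x \<in> {0..l}"
  obtain M where M: "\<And>x. x \<in> {0..l} \<Longrightarrow> \<bar>(r x)\<^sup>2\<bar> \<le> M" "\<And>x. x \<in> {0..l} \<Longrightarrow> \<bar>1 / (r x)\<^sup>2\<bar> \<le> M"
    using area_bounds by blast
  show "(sinP k has_vector_derivative sinV k x / of_real ((r x)\<^sup>2)) (at x within {0..l})"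
    using odd_series_has_vector_derivative[OF area_cont(2,1) l M(2,1) x, of "- k\<^sup>2"]
    by (simp add: sinP_def sinV_def)
  show "(sinV k has_vector_derivative - (k\<^sup>2 * of_real ((r x)\<^sup>2) * sinP k x)) (at x within {0..l})"
    using even_series_has_vector_derivative[OF area_cont(2,1) l M(2,1) x, of "- k\<^sup>2"]
    by (simp add: sinP_def sinV_def)
qed

lemma fundamental_det:
  assumes "x \<in> {0..l}"
  shows "cosP k x * sinV k x - cosV k x * sinP k x = 1"
  using canonical_wronskian[OF canonical_sol_cos canonical_sol_sin assms, of 0 k] l
  by (simp add: fundamental_at_0)

text \<open>The Wronskians with the two fundamental solutions express the data at 0 by the values at
  x, and determinant 1 inverts this relation. Hence the values at any one point determine a
  solution.\<close>

lemma canonical_sol_eq: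
  assumes "canonical_sol k P V" and x: "x \<in> {0..l}"
  shows "P x = P 0 * cosP k x + V 0 * sinP k x" "V x = P 0 * cosV k x + V 0 * sinV k x"
    and "P 0 = P x * sinV k x - V x * sinP k x" "V 0 = V x * cosP k x - P x * cosV k x"
proof -
  have 0: "0 \<in> {0..l}" using l by simp
  show P0: "P 0 = P x * sinV k x - V x * sinP k x"
    using canonical_wronskian[OF assms(1) canonical_sol_sin x 0] by (simp add: fundamental_at_0)
  show V0: "V 0 = V x * cosP k x - P x * cosV k x"
    using canonical_wronskian[OF assms(1) canonical_sol_cos x 0]
    by (simp add: fundamental_at_0 algebra_simps)
  have "P 0 * cosP k x + V 0 * sinP k x = P x * (cosP k x * sinV k x - cosV k x * sinP k x)"
    "P 0 * cosV k x + V 0 * sinV k x = V x * (cosP k x * sinV k x - cosV k x * sinP k x)"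
    unfolding P0 V0 by (simp_all add: algebra_simps)
  then show "P x = P 0 * cosP k x + V 0 * sinP k x" "V x = P 0 * cosV k x + V 0 * sinV k x"
    using fundamental_det[OF x] by simp_all
qed

lemma canonical_sol_unique:
  assumes "canonical_sol k P1 V1" "canonical_sol k P2 V2"
    and "y \<in> {0..l}" "P1 y = P2 y" "V1 y = V2 y" and "x \<in> {0..l}"
  shows "P1 x = P2 x"
  using canonical_sol_eq[OF assms(1)] canonical_sol_eq[OF assms(2)] assms(3-) by metis

text \<open>Liouville transformation \<open>\<psi> = r P\<close>: the coefficients of the canonical system are continuous,
  so that a Caratheodory solution of the Schroedinger equation becomes a classical one.\<close>
lemma schroedinger_sol_imp_canonical:
  assumes "schroedinger_sol l r k \<psi>"
  shows "canonical_sol k (\<lambda>x. \<psi> x / of_real (r x))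
           (\<lambda>x. of_real (r x) * ideriv l \<psi> x - of_real (r' x) * \<psi> x)"
    (is "canonical_sol k ?P ?V")
  unfolding canonical_sol_def
proof (intro ballI conjI)
  let ?\<psi>' = "ideriv l \<psi>"
  have d: "(\<psi> has_vector_derivative ?\<psi>' x) (at x within {0..l})" if "x \<in> {0..l}" for x
    using assms that by (auto simp: schroedinger_sol_def intro: ideriv_has_vector_derivative)
  have ac: "abs_continuous_on 0 l ?\<psi>'" using assms by (simp add: schroedinger_sol_def)
  have \<psi>_cont: "continuous_on {0..l} \<psi>" using d by (rule continuous_on_vector_derivative)
  fix x assume x: "x \<in> {0..l}"
  show "(?V has_vector_derivative - (k\<^sup>2 * of_real ((r x)\<^sup>2) * ?P x)) (at x within {0..l})"
  \<comment> \<open>The equation for \<open>V\<close> is known only almost everywhere at first;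
    continuity of its right-hand side extends it to the whole closed interval.\<close>
  proof (rule has_vector_derivative_AE_continuous[OF _ _ x])
    show "abs_continuous_on 0 l ?V"
      by (intro abs_continuous_on_diff abs_continuous_on_mult abs_continuous_on_of_real ac r'_ac
          abs_continuous_on_C1[OF r_deriv r'_cont] abs_continuous_on_C1[OF d]
          abs_continuous_on_imp_continuous_on[OF ac])
    show "continuous_on {0..l} (\<lambda>x. - (k\<^sup>2 * of_real ((r x)\<^sup>2) * ?P x))"
      using r_nonzero by (intro continuous_intros r_cont \<psi>_cont) force
    have "AE x\<in>{0<..<l} in lebesgue. ?\<psi>' differentiable (at x) \<and>
        - ideriv l ?\<psi>' x + of_real (potential l r x) * \<psi> x = k\<^sup>2 * \<psi> x"
      using assms by (simp add: schroedinger_sol_def)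
    with r'_ae show "AE x\<in>{0<..<l} in lebesgue.
        (?V has_vector_derivative - (k\<^sup>2 * of_real ((r x)\<^sup>2) * ?P x)) (at x)"
    proof eventually_elim
      case (elim x)
      show ?case
      proof
        assume x: "x \<in> {0<..<l}"
        then have x': "x \<in> {0..l}" and at: "at x within {0..l} = at x"
          by (auto intro: at_within_Icc_at)
        have rx: "r x \<noteq> 0" using r_pos[OF x'] by simp
        note r2 = ideriv_has_vector_derivative_at[OF mp[OF elim(1) x] x]
        have \<psi>2: "(?\<psi>' has_vector_derivative ideriv l ?\<psi>' x) (at x)"
          and eq: "ideriv l ?\<psi>' x = of_real (ideriv l r' x / r x) * \<psi> x - k\<^sup>2 * \<psi> x"
          using elim(2) x by (auto intro!: ideriv_has_vector_derivative_at
              simp: potential_def algebra_simps)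
        \<comment> \<open>The products of first derivatives cancel, and q = r''/r removes r'' from
          what is left.\<close>
        have "(?V has_vector_derivative
           (of_real (r x) * ideriv l ?\<psi>' x + of_real (r' x) * ?\<psi>' x) -
           (of_real (r' x) * ?\<psi>' x + of_real (ideriv l r' x) * \<psi> x)) (at x)"
          by (intro has_vector_derivative_diff has_vector_derivative_mult \<psi>2
              d[OF x', unfolded at] r_deriv_complex[OF x', unfolded at]
              has_vector_derivative_of_real r2[folded has_real_derivative_iff_has_vector_derivative])
        also have "of_real (r x) * ideriv l ?\<psi>' x + of_real (r' x) * ?\<psi>' x -
           (of_real (r' x) * ?\<psi>' x + of_real (ideriv l r' x) * \<psi> x) = - (k\<^sup>2 * of_real ((r x)\<^sup>2) * ?P x)"
          unfolding eq using rx by (simp add: field_simps power2_eq_square)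
        finally show "(?V has_vector_derivative - (k\<^sup>2 * of_real ((r x)\<^sup>2) * ?P x)) (at x)" .
      qed
    qed
  qed
  have rx: "r x \<noteq> 0" using r_pos[OF x] by simp
  from has_vector_derivative_mult[OF d[OF x] inverse_r_deriv[OF x]]
  show "(?P has_vector_derivative ?V x / of_real ((r x)\<^sup>2)) (at x within {0..l})"
    using rx by (simp add: field_simps power2_eq_square)
qed

text \<open>Converse of the Liouville transformation. \<open>\<psi>\<close> is prescribed on the
  interval only, so that restrictions qualify; the formula for its derivative translates the data at
  0 and at l.\<close>

lemma canonical_imp_schroedinger_sol:
  assumes sol: "canonical_sol k P V" and \<psi>: "\<And>x. x \<in> {0..l} \<Longrightarrow> \<psi> x = of_real (r x) * P x"
  shows "x \<in> {0..l} \<Longrightarrow> ideriv l \<psi> x = of_real (r' x) * P x + V x / of_real (r x)"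
    and "schroedinger_sol l r k \<psi>"
proof -
  let ?d = "\<lambda>x. of_real (r' x) * P x + V x / of_real (r x)"
  have d: "(\<psi> has_vector_derivative ?d x) (at x within {0..l})" if x: "x \<in> {0..l}" for x
  proof (rule has_vector_derivative_transform[OF x \<psi>])
    have "((\<lambda>x. of_real (r x) * P x) has_vector_derivative
        of_real (r x) * (V x / of_real ((r x)\<^sup>2)) + of_real (r' x) * P x) (at x within {0..l})"
      by (intro has_vector_derivative_mult r_deriv_complex canonical_solD[OF sol] x)
    then show "((\<lambda>x. of_real (r x) * P x) has_vector_derivative ?d x) (at x within {0..l})"
      using r_pos[OF x] by (simp add: power2_eq_square add.commute)
  qed
  show id: "ideriv l \<psi> x = ?d x" if "x \<in> {0..l}" for x
    by (rule ideriv_eqI[OF l that d[OF that]])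
  have Vac: "abs_continuous_on 0 l V" and Pac: "abs_continuous_on 0 l P"
    using r_pos by (force intro!: abs_continuous_on_C1[OF canonical_solD(2)[OF sol]]
      abs_continuous_on_C1[OF canonical_solD(1)[OF sol]] continuous_intros r_cont
      canonical_sol_continuous[OF sol])+
  have "abs_continuous_on 0 l (\<lambda>x. complex_of_real (inverse (r x)))"
    by (rule abs_continuous_on_C1[OF inverse_r_deriv])
       (use r_pos in \<open>force intro!: continuous_intros r_cont r'_cont\<close>)+
  then have *: "abs_continuous_on 0 l (\<lambda>x. of_real (r' x) * P x + V x * of_real (inverse (r x)))"
    by (intro abs_continuous_on_add abs_continuous_on_mult abs_continuous_on_of_real[OF r'_ac] Vac Pac)
  \<comment> \<open>Absolute continuity sees only values on the interval, so it passes along the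
    equation \<open>id\<close>.\<close>
  have "abs_continuous_on 0 l (ideriv l \<psi>)"
    by (rule abs_continuous_on_dominated[OF * *, of 1]) (simp_all add: id divide_inverse)
  moreover have "\<psi> differentiable_on {0..l}"
    unfolding differentiable_on_def by (blast intro: differentiableI_vector d)
  moreover have "AE x\<in>{0<..<l} in lebesgue. ideriv l \<psi> differentiable (at x) \<and>
        - ideriv l (ideriv l \<psi>) x + of_real (potential l r x) * \<psi> x = k\<^sup>2 * \<psi> x"
    using r'_ae
  proof (rule eventually_mono, intro impI)
    fix x assume *: "x \<in> {0<..<l} \<longrightarrow> r' differentiable (at x)" and x: "x \<in> {0<..<l}"
    then have x': "x \<in> {0..l}" and at: "at x within {0..l} = at x"
      by (auto intro: at_within_Icc_at)
    have rx: "r x \<noteq> 0" using r_pos[OF x'] by simp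
    have r2: "(r' has_vector_derivative ideriv l r' x) (at x within {0..l})"
      using * x at by (auto intro: ideriv_has_vector_derivative_at)
    have "((\<lambda>x. of_real (r' x) * P x + V x * of_real (inverse (r x))) has_vector_derivative
        (of_real (r' x) * (V x / of_real ((r x)\<^sup>2)) + of_real (ideriv l r' x) * P x) +
        (V x * of_real (- (inverse (r x) * r' x * inverse (r x))) +
          - (k\<^sup>2 * of_real ((r x)\<^sup>2) * P x) * of_real (inverse (r x)))) (at x within {0..l})"
      by (intro has_vector_derivative_add has_vector_derivative_mult canonical_solD[OF sol x']
          inverse_r_deriv[OF x'] has_vector_derivative_of_real r2[folded has_real_derivative_iff_has_vector_derivative])
    also have "(of_real (r' x) * (V x / of_real ((r x)\<^sup>2)) + of_real (ideriv l r' x) * P x) +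
        (V x * of_real (- (inverse (r x) * r' x * inverse (r x))) +
          - (k\<^sup>2 * of_real ((r x)\<^sup>2) * P x) * of_real (inverse (r x)))
        = of_real (potential l r x) * \<psi> x - k\<^sup>2 * \<psi> x"
      unfolding potential_def using rx \<psi>[OF x'] by (simp add: field_simps power2_eq_square)
    finally have "(ideriv l \<psi> has_vector_derivative of_real (potential l r x) * \<psi> x - k\<^sup>2 * \<psi> x) (at x within {0..l})"
      by (rule has_vector_derivative_transform[OF x', rotated]) (simp add: id divide_inverse)
    from this ideriv_eqI[OF l x' this] show "ideriv l \<psi> differentiable (at x) \<and>
        - ideriv l (ideriv l \<psi>) x + of_real (potential l r x) * \<psi> x = k\<^sup>2 * \<psi> x"
      using at by (auto intro: differentiableI_vector)
  qed
  ultimately show "schroedinger_sol l r k \<psi>" by (simp add: schroedinger_sol_def)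
qed

section \<open>The solutions phi and g and their Wronskian\<close>

text \<open>One statement evaluates both definite descriptions: \<open>phi\<close> with y = 0 and
  \<open>jost\<close> with y = l. Existence and uniqueness are transferred from the canonical
  system.\<close>

lemma schroedinger_sol_THE:
  assumes sol: "canonical_sol k P V" and y: "y \<in> {0..l}"
    and a: "a = of_real (r y) * P y" and b: "b = of_real (r' y) * P y + V y / of_real (r y)"
  shows "(THE \<psi>. \<psi> \<in> extensional {0..l} \<and> schroedinger_sol l r k \<psi> \<and> \<psi> y = a \<and> ideriv l \<psi> y = b)
    = restrict (\<lambda>x. of_real (r x) * P x) {0..l}" (is "_ = ?\<psi>")
proof (rule the_equality)
  have \<psi>: "?\<psi> x = of_real (r x) * P x" if "x \<in> {0..l}" for x using that by simp
  show "?\<psi> \<in> extensional {0..l} \<and> schroedinger_sol l r k ?\<psi> \<and> ?\<psi> y = a \<and> ideriv l ?\<psi> y = b"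
    using canonical_imp_schroedinger_sol(1)[OF sol \<psi> y] canonical_imp_schroedinger_sol(2)[OF sol \<psi>]
      \<psi>[OF y] by (simp only: a b restrict_extensional simp_thms)
next
  fix \<psi> assume *: "\<psi> \<in> extensional {0..l} \<and> schroedinger_sol l r k \<psi> \<and> \<psi> y = a \<and> ideriv l \<psi> y = b"
  then have s: "schroedinger_sol l r k \<psi>" by simp
  have ry: "r y \<noteq> 0" using r_pos[OF y] by simp
  show "\<psi> = ?\<psi>"
  proof (rule extensionalityI[of _ "{0..l}"])
    fix x assume x: "x \<in> {0..l}"
    have "\<psi> x / of_real (r x) = P x"
      by (rule canonical_sol_unique[OF schroedinger_sol_imp_canonical[OF s] sol y _ _ x])
         (use * a b ry in \<open>simp_all add: field_simps\<close>)
    then show "\<psi> x = ?\<psi> x" using r_pos[OF x] x by (auto simp: field_simps)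
  qed (use * in auto)
qed

text \<open>In canonical variables the data of phi read P(0) = 1/r_0 and V(0) = 0.\<close>

lemma phi_eq: "phi l r k = restrict (\<lambda>x. of_real (r x) * (cosP k x / of_real (r 0))) {0..l}"
proof -
  have 0: "0 \<in> {0..l}" and r0: "r 0 \<noteq> 0" using l r_pos[of 0] by auto
  have sol: "canonical_sol k (\<lambda>x. cosP k x / of_real (r 0)) (\<lambda>x. cosV k x / of_real (r 0))"
    using canonical_sol_lincomb[OF canonical_sol_cos canonical_sol_cos, of k "1 / of_real (r 0)" 0] by simp
  show ?thesis
    unfolding phi_def by (rule schroedinger_sol_THE[OF sol 0]) (use r0 in \<open>simp_all add: fundamental_at_0\<close>)
qed

text \<open>The data of g in canonical variables are P(l) = z/r_l and V(l) = -i k r_l. The two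
  coefficients are the corresponding data at 0, computed by the inversion in
  \<open>canonical_sol_eq\<close>.\<close>

definition "jostP k = (\<lambda>x.
  (impedance l r k / of_real (r l) * sinV k l + \<i> * k * of_real (r l) * sinP k l) * cosP k x +
  (- (\<i> * k * of_real (r l)) * cosP k l - impedance l r k / of_real (r l) * cosV k l) * sinP k x)"
definition "jostV k = (\<lambda>x.
  (impedance l r k / of_real (r l) * sinV k l + \<i> * k * of_real (r l) * sinP k l) * cosV k x +
  (- (\<i> * k * of_real (r l)) * cosP k l - impedance l r k / of_real (r l) * cosV k l) * sinV k x)"

lemma canonical_sol_jost: "canonical_sol k (jostP k) (jostV k)"
  unfolding jostP_def jostV_def by (rule canonical_sol_lincomb[OF canonical_sol_cos canonical_sol_sin])

lemma jost_at_l: "jostP k l = impedance l r k / of_real (r l)" "jostV k l = - (\<i> * k * of_real (r l))"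
proof -
  have "jostP k l = impedance l r k / of_real (r l) * (cosP k l * sinV k l - cosV k l * sinP k l)"
    "jostV k l = - (\<i> * k * of_real (r l)) * (cosP k l * sinV k l - cosV k l * sinP k l)"
    by (simp_all add: jostP_def jostV_def algebra_simps)
  then show "jostP k l = impedance l r k / of_real (r l)" "jostV k l = - (\<i> * k * of_real (r l))"
    using fundamental_det[of l k] l by simp_all
qed

lemma jost_eq: "jost l r k = restrict (\<lambda>x. of_real (r x) * jostP k x) {0..l}"
proof -
  have l': "l \<in> {0..l}" and rl: "r l \<noteq> 0" using l r_pos[of l] by auto
  show ?thesis
    unfolding jost_def
    by (rule schroedinger_sol_THE[OF canonical_sol_jost l']) (use rl in \<open>simp_all add: jost_at_l\<close>)
qed

text \<open>Under the Liouville transformation the terms with r' cancel and the Wronskian becomes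
  the constant canonical one. It is evaluated at l, where the data of g are prescribed.\<close>

lemma G_eq:
  "G l r k = - (\<i> * k * of_real (r l) * cosP k l + impedance l r k / of_real (r l) * cosV k l) / of_real (r 0)"
    (is "_ = ?g")
proof -
  have l': "l \<in> {0..l}" and r0: "r 0 \<noteq> 0" using l r_pos[of 0] by auto
  have sol: "canonical_sol k (\<lambda>x. cosP k x / of_real (r 0)) (\<lambda>x. cosV k x / of_real (r 0))"
    using canonical_sol_lincomb[OF canonical_sol_cos canonical_sol_cos, of k "1 / of_real (r 0)" 0] by simp
  have W: "phi l r k x * ideriv l (jost l r k) x - ideriv l (phi l r k) x * jost l r k x = ?g"
    if x: "x \<in> {0..l}" for x
  proof -
    have rx: "r x \<noteq> 0" using r_pos[OF x] by simp
    have ph: "phi l r k x = of_real (r x) * (cosP k x / of_real (r 0))"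
      and jo: "jost l r k x = of_real (r x) * jostP k x" if "x \<in> {0..l}" for x
      using that by (simp_all add: phi_eq jost_eq)
    have dph: "ideriv l (phi l r k) x = of_real (r' x) * (cosP k x / of_real (r 0)) +
        cosV k x / of_real (r 0) / of_real (r x)"
      by (rule canonical_imp_schroedinger_sol(1)[OF sol ph x])
    have djo: "ideriv l (jost l r k) x = of_real (r' x) * jostP k x + jostV k x / of_real (r x)"
      by (rule canonical_imp_schroedinger_sol(1)[OF canonical_sol_jost jo x])
    have "phi l r k x * ideriv l (jost l r k) x - ideriv l (phi l r k) x * jost l r k x
        = cosP k x / of_real (r 0) * jostV k x - cosV k x / of_real (r 0) * jostP k x"
      unfolding dph djo ph[OF x] jo[OF x]
      using rx r0 by (simp add: field_simps)
    also have "\<dots> = cosP k l / of_real (r 0) * jostV k l - cosV k l / of_real (r 0) * jostP k l"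
      by (rule canonical_wronskian[OF sol canonical_sol_jost x l'])
    also have "\<dots> = ?g"
      by (simp add: jost_at_l diff_divide_distrib add_divide_distrib mult_ac)
    finally show ?thesis .
  qed
  show ?thesis
    unfolding G_def by (rule the_equality) (use W l' in auto)
qed

section \<open>The boundary value problem for the pressure\<close>

text \<open>With V = r^2 p' the factor r_0^2 disappears from the condition at 0.\<close>

lemma pressure_bvp_iff:
  "pressure_bvp l r c \<mu> k p \<longleftrightarrow> (\<exists>V. canonical_sol k p V \<and>
     V 0 = - (\<i> * k * of_real (c * \<mu>) / of_real pi) \<and>
     V l / of_real ((r l)\<^sup>2) + \<i> * k / impedance l r k * p l = 0)"
proof
  have 0: "0 \<in> {0..l}" and l': "l \<in> {0..l}" using l by auto
  have r0: "r 0 \<noteq> 0" and rl: "r l \<noteq> 0" using r_pos[OF 0] r_pos[OF l'] by auto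
  {
    assume bvp: "pressure_bvp l r c \<mu> k p"
    define V where "V = (\<lambda>x. of_real ((r x)\<^sup>2) * ideriv l p x)"
    define h where "h = (\<lambda>x. - (k\<^sup>2 * of_real ((r x)\<^sup>2) * p x))"
    have dp: "(p has_vector_derivative ideriv l p x) (at x within {0..l})" if "x \<in> {0..l}" for x
      using bvp that by (auto simp: pressure_bvp_def intro: ideriv_has_vector_derivative)
    have pc: "continuous_on {0..l} p" using dp by (rule continuous_on_vector_derivative)
    have hc: "continuous_on {0..l} h" unfolding h_def by (intro continuous_intros r_cont pc)
    have Vc: "continuous_on {0..l} V" unfolding V_def
      using bvp by (intro continuous_intros r_cont) (auto simp: pressure_bvp_def)
    \<comment> \<open>The equation is given on the open interval only; continuity of
      \<open>V\<close> up to the ends makes it a primitive of \<open>h\<close> on the closed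
      one.\<close>
    have "V x = V 0 + integral {0..x} h" if "x \<in> {0..l}" for x
    proof -
      have "(h has_integral (V x - V 0)) {0..x}"
        using that Vc bvp
        by (intro fundamental_theorem_of_calculus_interior)
           (auto intro: continuous_on_subset simp: pressure_bvp_def V_def h_def)
      then show ?thesis by (simp add: has_integral_iff)
    qed
    then have dV: "(V has_vector_derivative h x) (at x within {0..l})" if "x \<in> {0..l}" for x
      using has_vector_derivative_if_integral_eq[OF hc that] by blast
    have "canonical_sol k p V"
      unfolding canonical_sol_def
    proof (intro ballI conjI)
      fix x assume x: "x \<in> {0..l}"
      show "(p has_vector_derivative V x / of_real ((r x)\<^sup>2)) (at x within {0..l})"
        using dp[OF x] r_pos[OF x] by (simp add: V_def)
      show "(V has_vector_derivative - (k\<^sup>2 * of_real ((r x)\<^sup>2) * p x)) (at x within {0..l})"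
        using dV[OF x] by (simp add: h_def)
    qed
    moreover have "V 0 = - (\<i> * k * of_real (c * \<mu>) / of_real pi)"
      using bvp r0 by (simp add: pressure_bvp_def V_def)
    moreover have "V l / of_real ((r l)\<^sup>2) + \<i> * k / impedance l r k * p l = 0"
      using bvp rl by (simp add: pressure_bvp_def V_def)
    ultimately show "\<exists>V. canonical_sol k p V \<and>
       V 0 = - (\<i> * k * of_real (c * \<mu>) / of_real pi) \<and>
       V l / of_real ((r l)\<^sup>2) + \<i> * k / impedance l r k * p l = 0" by blast
  next
    assume "\<exists>V. canonical_sol k p V \<and>
       V 0 = - (\<i> * k * of_real (c * \<mu>) / of_real pi) \<and>
       V l / of_real ((r l)\<^sup>2) + \<i> * k / impedance l r k * p l = 0"
    then obtain V where sol: "canonical_sol k p V"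
      and V0: "V 0 = - (\<i> * k * of_real (c * \<mu>) / of_real pi)"
      and Vl: "V l / of_real ((r l)\<^sup>2) + \<i> * k / impedance l r k * p l = 0" by blast
    have id: "ideriv l p x = V x / of_real ((r x)\<^sup>2)" if "x \<in> {0..l}" for x
      by (rule ideriv_eqI[OF l that canonical_solD(1)[OF sol that]])
    have "continuous_on {0..l} (ideriv l p)"
    proof (subst continuous_on_cong[OF refl id])
      show "continuous_on {0..l} (\<lambda>x. V x / of_real ((r x)\<^sup>2))"
        using r_nonzero by (intro continuous_intros canonical_sol_continuous[OF sol] r_cont) force
    qed
    moreover have "((\<lambda>y. of_real ((r y)\<^sup>2) * ideriv l p y)
           has_vector_derivative - (k\<^sup>2 * of_real ((r x)\<^sup>2) * p x)) (at x)" if "x \<in> {0<..<l}" for x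
    proof -
      have x: "x \<in> {0..l}" and at: "at x within {0..l} = at x"
        using that by (auto intro: at_within_Icc_at)
      have "of_real ((r y)\<^sup>2) * ideriv l p y = V y" if "y \<in> {0..l}" for y
        using r_pos[OF that] by (simp add: id[OF that])
      from has_vector_derivative_transform[OF x this canonical_solD(2)[OF sol x]]
      show ?thesis unfolding at .
    qed
    moreover have "p differentiable_on {0..l}"
      unfolding differentiable_on_def by (blast intro: differentiableI_vector canonical_solD(1)[OF sol])
    ultimately show "pressure_bvp l r c \<mu> k p"
      unfolding pressure_bvp_def id[OF 0] id[OF l'] V0 using Vl by simp
  }
qed

lemma pressure_sol_at_l:
  assumes z: "impedance l r k \<noteq> 0" and g: "G l r k \<noteq> 0"
  shows "pressure_sol l r c \<mu> k l =
    - (\<i> * k * of_real (c * \<mu>) / of_real (pi * r 0 * r l)) * (impedance l r k / G l r k)"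
proof -
  let ?z = "impedance l r k"
  have 0: "0 \<in> {0..l}" and l': "l \<in> {0..l}" using l by auto
  have r0: "r 0 \<noteq> 0" and rl: "r l \<noteq> 0" using r_pos[OF 0] r_pos[OF l'] by auto
  \<comment> \<open>\<open>b\<close> is the prescribed V(0). \<open>N\<close> and \<open>M\<close>
    are the left-hand side of the condition at l, multiplied by z r_l^2, for the two fundamental
    solutions.\<close>
  define b where "b = - (\<i> * k * of_real (c * \<mu>) / of_real pi)"
  define N where "N = ?z * cosV k l + \<i> * k * of_real ((r l)\<^sup>2) * cosP k l"
  define M where "M = ?z * sinV k l + \<i> * k * of_real ((r l)\<^sup>2) * sinP k l"
  have N: "N = - (G l r k * of_real (r 0) * of_real (r l))"
    using r0 rl by (simp add: N_def G_eq field_simps power2_eq_square)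
  then have N0: "N \<noteq> 0" using g r0 rl by simp
  define a where "a = - (b * M / N)"
  define P where "P = (\<lambda>x. a * cosP k x + b * sinP k x)"
  define V where "V = (\<lambda>x. a * cosV k x + b * sinV k x)"
  \<comment> \<open>Once V(0) = b, the condition at l is the linear equation p(0) N + b M = 0, whose
    only root is \<open>a\<close>. The equivalence gives both existence and uniqueness.\<close>
  have bc: "V' l / of_real ((r l)\<^sup>2) + \<i> * k / ?z * p l = 0 \<longleftrightarrow>
      p 0 = a" if sol: "canonical_sol k p V'" and V0: "V' 0 = b" for p V'
  proof -
    have "V' l / of_real ((r l)\<^sup>2) + \<i> * k / ?z * p l
        = (?z * V' l + \<i> * k * of_real ((r l)\<^sup>2) * p l) / (?z * of_real ((r l)\<^sup>2))"
      using z rl by (simp add: field_simps)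
    also have "?z * V' l + \<i> * k * of_real ((r l)\<^sup>2) * p l = p 0 * N + b * M"
      unfolding canonical_sol_eq(1,2)[OF sol l'] V0 N_def M_def by (simp add: algebra_simps)
    finally show ?thesis
      using z rl N0 by (simp add: a_def field_simps add_eq_0_iff)
  qed
  have sol: "canonical_sol k P V"
    unfolding P_def V_def by (rule canonical_sol_lincomb[OF canonical_sol_cos canonical_sol_sin])
  have P0: "P 0 = a" "V 0 = b" by (simp_all add: P_def V_def fundamental_at_0)
  have "pressure_sol l r c \<mu> k = restrict P {0..l}"
    unfolding pressure_sol_def
  proof (rule the_equality)
    have "canonical_sol k (restrict P {0..l}) V"
      unfolding canonical_sol_def
    proof (intro ballI conjI)
      fix x assume x: "x \<in> {0..l}"
      show "(restrict P {0..l} has_vector_derivative V x / of_real ((r x)\<^sup>2)) (at x within {0..l})"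
        by (rule has_vector_derivative_transform[OF x _ canonical_solD(1)[OF sol x]]) simp
      show "(V has_vector_derivative - (k\<^sup>2 * of_real ((r x)\<^sup>2) * restrict P {0..l} x)) (at x within {0..l})"
        using canonical_solD(2)[OF sol x] x by simp
    qed
    moreover have "V l / of_real ((r l)\<^sup>2) + \<i> * k / ?z * restrict P {0..l} l = 0"
      using bc[OF sol] P0 l' by simp
    ultimately show "restrict P {0..l} \<in> extensional {0..l} \<and> pressure_bvp l r c \<mu> k (restrict P {0..l})"
      using P0 by (auto simp: pressure_bvp_iff b_def)
  next
    fix p assume p: "p \<in> extensional {0..l} \<and> pressure_bvp l r c \<mu> k p"
    then obtain V' where sol': "canonical_sol k p V'" and V0: "V' 0 = b"
      and "V' l / of_real ((r l)\<^sup>2) + \<i> * k / ?z * p l = 0"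
      by (auto simp: pressure_bvp_iff b_def)
    then have "p 0 = a" using bc by blast
    show "p = restrict P {0..l}"
    proof (rule extensionalityI[of _ "{0..l}"])
      fix x assume x: "x \<in> {0..l}"
      show "p x = restrict P {0..l} x"
        using canonical_sol_unique[OF sol' sol 0 _ _ x] \<open>p 0 = a\<close> V0 P0 x by simp
    qed (use p in auto)
  qed
  then have "pressure_sol l r c \<mu> k l = P l" using l' by simp
  also have "P l = b * (sinP k l * N - cosP k l * M) / N"
    using N0 by (simp add: P_def a_def field_simps)
  \<comment> \<open>The terms with i k r_l^2 cancel, leaving the determinant of the fundamental
    matrix.\<close>
  also have "sinP k l * N - cosP k l * M = - ?z * (cosP k l * sinV k l - cosV k l * sinP k l)"
    by (simp add: N_def M_def algebra_simps)
  also have "\<dots> = - ?z" using fundamental_det[OF l'] by simp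
  finally show ?thesis
    unfolding N b_def using g r0 rl by (simp add: field_simps)
qed

section \<open>Dependence on k and the meromorphic identity\<close>

text \<open>The odd series appears in place of \<open>cosV\<close>, so that the factor k^2 stays
  visible when k is divided out of \<open>G\<close>.\<close>

lemma holomorphic_fundamental_at_l:
  "(\<lambda>k. cosP k l) holomorphic_on UNIV"
  "(\<lambda>k. odd_series (\<lambda>x. (r x)\<^sup>2) (\<lambda>x. 1 / (r x)\<^sup>2) (- k\<^sup>2) l) holomorphic_on UNIV"
proof -
  obtain M where M: "\<And>x. x \<in> {0..l} \<Longrightarrow> \<bar>(r x)\<^sup>2\<bar> \<le> M" "\<And>x. x \<in> {0..l} \<Longrightarrow> \<bar>1 / (r x)\<^sup>2\<bar> \<le> M"
    using area_bounds by blast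
  have l': "l \<in> {0..l}" using l by simp
  have s: "(\<lambda>k::complex. - k\<^sup>2) holomorphic_on UNIV" by (intro holomorphic_intros)
  show "(\<lambda>k. cosP k l) holomorphic_on UNIV"
    "(\<lambda>k. odd_series (\<lambda>x. (r x)\<^sup>2) (\<lambda>x. 1 / (r x)\<^sup>2) (- k\<^sup>2) l) holomorphic_on UNIV"
    unfolding cosP_def by (rule holomorphic_on_UNIV_compose[OF s] holomorphic_series area_cont l M l' | assumption)+
qed

text \<open>One term of \<open>G\<close> carries the factor k explicitly, the other through the k^2
  in \<open>cosV\<close>. At k = 0 the remaining factor equals -i r_l / r_0, so \<open>G\<close>
  does not vanish identically.\<close>

lemma G_factor:
  obtains H where "\<And>k. G l r k = k * H k" "H holomorphic_on UNIV" "H 0 \<noteq> 0"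
proof -
  have rl: "r l > 0" and r0: "r 0 > 0" using r_pos l by auto
  define S where "S = (\<lambda>k. odd_series (\<lambda>x. (r x)\<^sup>2) (\<lambda>x. 1 / (r x)\<^sup>2) (- k\<^sup>2) l)"
  define H where "H = (\<lambda>k. - (\<i> * of_real (r l) * cosP k l
      - k * (impedance l r k / of_real (r l)) * S k) / of_real (r 0))"
  show ?thesis
  proof
    show "G l r k = k * H k" for k
      by (simp add: G_eq H_def S_def cosV_def power2_eq_square algebra_simps)
    show "H holomorphic_on UNIV"
      unfolding H_def S_def using rl r0
      by (intro holomorphic_intros holomorphic_fundamental_at_l holomorphic_impedance[of r l]) auto
    show "H 0 \<noteq> 0"
      using rl r0 by (simp add: H_def cosP_def even_series_0)
  qed
qed

end

text \<open>The identity is read as follows: both sides are meromorphic, the exceptional k form a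
  sparse set, and the values agree at every other k. At a zero of \<open>G\<close> the quotient in
  \<open>F\<close> is 0 by the convention for division, while \<open>pressure\<close> takes the
  limit, or 0 at a pole.\<close>

theorem proposition5p2:
  fixes l c \<mu> :: real and r :: "real \<Rightarrow> real"
  assumes "l > 0" and "c > 0" and "\<mu> > 0"
    and "class_A l r"
  defines "F \<equiv> \<lambda>k::complex. - (\<i> * k * of_real (c * \<mu>) / of_real (pi * r 0 * r l))
                               * (impedance l r k / G l r k)"
  shows "(\<lambda>k. pressure l r c \<mu> k l) meromorphic_on UNIV \<and>
         F meromorphic_on UNIV \<and>
         (\<forall>\<^sub>\<approx>k\<in>UNIV. impedance l r k \<noteq> 0 \<and> G l r k \<noteq> 0) \<and>
         (\<forall>k. impedance l r k \<noteq> 0 \<and> G l r k \<noteq> 0 \<longrightarrow> pressure l r c \<mu> k l = F k) \<and>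
         (\<forall>\<^sub>\<approx>k\<in>UNIV. pressure l r c \<mu> k l = F k)"
proof -
  interpret vocal_tract l r by standard fact+
  have rl: "r l > 0" using r_pos l by simp
  obtain H where H: "\<And>k. G l r k = k * H k" "H holomorphic_on UNIV" "H 0 \<noteq> 0"
    using G_factor by blast
  have z: "impedance l r holomorphic_on UNIV" by (rule holomorphic_impedance[of r l, OF rl])
  have g: "G l r holomorphic_on UNIV" unfolding H(1)[abs_def] by (intro holomorphic_intros H(2))
  obtain k1 where "impedance l r k1 \<noteq> 0" using impedance_nonzero[of r l, OF rl] by blast
  then have "\<forall>\<^sub>\<approx>k\<in>UNIV. impedance l r k \<noteq> 0" by (rule holomorphic_nonzero_cosparse[OF z])
  moreover have "\<forall>\<^sub>\<approx>k\<in>UNIV. H k \<noteq> 0" by (rule holomorphic_nonzero_cosparse[OF H(2,3)])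
  moreover have "\<forall>\<^sub>\<approx>k\<in>(UNIV::complex set). k \<noteq> 0"
    by (rule holomorphic_nonzero_cosparse[of "\<lambda>k. k" 1]) (auto intro: holomorphic_intros)
  ultimately have nz: "\<forall>\<^sub>\<approx>k\<in>UNIV. impedance l r k \<noteq> 0 \<and> G l r k \<noteq> 0"
    by eventually_elim (simp add: H(1))
  have eq: "pressure l r c \<mu> k l = F k" if "impedance l r k \<noteq> 0" "G l r k \<noteq> 0" for k
    using that pressure_sol_at_l[OF that] by (simp add: pressure_def F_def)
  then have ae: "\<forall>\<^sub>\<approx>k\<in>UNIV. pressure l r c \<mu> k l = F k"
    using nz by (auto elim: eventually_mono)
  have "impedance l r meromorphic_on UNIV" "G l r meromorphic_on UNIV"
    using z g by (auto intro!: analytic_on_imp_meromorphic_on simp: analytic_on_open)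
  then have F: "F meromorphic_on UNIV"
    unfolding F_def by (intro meromorphic_intros) 
  \<comment> \<open>Being meromorphic is insensitive to values on a sparse set, so it passes from
    \<open>F\<close> to the pressure whatever the values at exceptional k.\<close>
  then have "(\<lambda>k. pressure l r c \<mu> k l) meromorphic_on UNIV"
    using meromorphic_on_cong'[OF ae refl] by simp
  then show ?thesis using F nz eq ae by blast
qed

end
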